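(* Let $c>1$ be a constant, let $n$ be a positive integer, let $s=s(n)\ge 1$ be an integer, and let $p=\frac{c\log n}{sn}$. Let $X$ be a set of $n$ vertices and let $\mathcal G=\{G_1,\dots,G_s\}$ be a family of $s$ graphs on $X$, each sampled independently from $G(n,p)$. If $$s\ge \frac{\log n}{\log c-1+\log\log n}+\frac32+\frac{2\sqrt{\log\log\log n}}{\log\log n},$$ then asymptotically almost surely $\mathcal G$ is rainbow connected.
   Context: $\log$ denotes the natural logarithm. $G(n,p)$ is the Erdős–Rényi random graph. A path $P$ with $E(P)\subseteq\bigcup_{i=1}^s E(G_i)$ is a rainbow path if there is an injection $\phi:E(P)\to[s]$ with $e\in E(G_{\phi(e)})$ for every $e\in E(P)$. The family $\mathcal G$ is rainbow connected if every pair of distinct vertices of $X$ is joined by a rainbow path. "Asymptotically almost surely" means with probability tending to $1$ as $n\to\infty$. *)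

theory Defs
  imports "HOL-Probability.Probability"
begin

text \<open>
  A simple graph on the vertex set \<open>X\<close> is identified with its edge set, a subset of
  \<open>all_edges X\<close>.
\<close>

definition all_edges :: "'a set \<Rightarrow> 'a set set" where
  "all_edges X = {e. e \<subseteq> X \<and> card e = 2}"

text \<open>
  Since \<open>bernoulli_pmf\<close> clamps its parameter to the unit interval, \<open>random_graph\<close> is
  total in \<open>p\<close>.
\<close>

definition random_graph :: "'a set \<Rightarrow> real \<Rightarrow> 'a set set pmf" where
  "random_graph X p =
     map_pmf (\<lambda>f. {e \<in> all_edges X. f e})
       (Pi_pmf (all_edges X) False (\<lambda>_. bernoulli_pmf p))"

definition random_graph_family :: "'a set \<Rightarrow> nat \<Rightarrow> real \<Rightarrow> (nat \<Rightarrow> 'a set set) pmf" where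
  "random_graph_family X s p = Pi_pmf {1..s} {} (\<lambda>_. random_graph X p)"

text \<open>A path is given by the list of its (pairwise distinct) vertices.\<close>

definition path_edges :: "'a list \<Rightarrow> 'a set set" where
  "path_edges vs = {{vs ! i, vs ! Suc i} | i. Suc i < length vs}"

definition path_between :: "'a set \<Rightarrow> 'a \<Rightarrow> 'a \<Rightarrow> 'a list \<Rightarrow> bool" where
  "path_between X u v vs \<longleftrightarrow>
     vs \<noteq> [] \<and> distinct vs \<and> set vs \<subseteq> X \<and> hd vs = u \<and> last vs = v"

definition rainbow_path :: "nat \<Rightarrow> (nat \<Rightarrow> 'a set set) \<Rightarrow> 'a list \<Rightarrow> bool" where
  "rainbow_path s G vs \<longleftrightarrow>
     path_edges vs \<subseteq> (\<Union>i\<in>{1..s}. G i) \<and>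
     (\<exists>\<phi>. \<phi> \<in> path_edges vs \<rightarrow> {1..s} \<and> inj_on \<phi> (path_edges vs) \<and>
          (\<forall>e\<in>path_edges vs. e \<in> G (\<phi> e)))"

definition rainbow_connected :: "'a set \<Rightarrow> nat \<Rightarrow> (nat \<Rightarrow> 'a set set) \<Rightarrow> bool" where
  "rainbow_connected X s G \<longleftrightarrow>
     (\<forall>u\<in>X. \<forall>v\<in>X. u \<noteq> v \<longrightarrow> (\<exists>vs. path_between X u v vs \<and> rainbow_path s G vs))"

end

theory Submission
  imports Defs "HOL-Real_Asymp.Real_Asymp"
begin

text \<open>
  Put \<open>L = ln n\<close> and let \<open>l\<close> be the least integer that is at least \<open>L / ln (c L / e) + 3 / 2\<close>, so that
  \<open>l \<le> s\<close>. Since \<open>c > 1\<close>, almost surely every vertex has at least \<open>\<epsilon> L\<close> neighbours, even after deleting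
  any single colour. Fix \<open>u\<close> and \<open>v\<close> and choose \<open>M = \<epsilon> L\<close> neighbours \<open>y\<close> of \<open>v\<close>, joined to \<open>v\<close> in colour \<open>j y\<close>.
  For each colour \<open>j = j y\<close>, explore from \<open>M\<close> neighbours of \<open>u\<close> level by level, never using the
  colour \<open>j\<close> nor a colour that already occurs on the path to the current vertex. Level \<open>k\<close> grows by a factor
  \<open>c L (1 - (k + 2) / s)\<close> up to losses whose product is bounded below, and because
  \<open>l! \<ge> (l / e) ^ l\<close> the product of these factors exceeds \<open>n\<close> within \<open>l - 3\<close> steps; hence some level
  \<open>J \<le> l - 3\<close> contains a constant proportion of all vertices. The unexposed edges between this level and the
  vertices \<open>y\<close>, in colours still unused, then number \<open>\<gg> L / p\<close>, so all of them are absent with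
  probability at most \<open>n\<^sup>-\<^sup>3\<close>, which survives the union bound over all pairs.
\<close>

section \<open>Independence in finite products\<close>

text \<open>Plays the part of measurability with respect to the coordinates in \<open>I\<close>. The
  arbitrary result type covers events as well as revealed random sets.\<close>

definition depends_on :: "'k set \<Rightarrow> (('k \<Rightarrow> 'v) \<Rightarrow> 'b) \<Rightarrow> bool" where
  "depends_on I f \<longleftrightarrow> (\<forall>\<omega> \<omega>'. (\<forall>k\<in>I. \<omega> k = \<omega>' k) \<longrightarrow> f \<omega> = f \<omega>')"

lemma depends_onI:
  "(\<And>\<omega> \<omega>'. (\<And>k. k \<in> I \<Longrightarrow> \<omega> k = \<omega>' k) \<Longrightarrow> f \<omega> = f \<omega>') \<Longrightarrow> depends_on I f"
  unfolding depends_on_def by blast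

lemma depends_onD:
  "depends_on I f \<Longrightarrow> (\<And>k. k \<in> I \<Longrightarrow> \<omega> k = \<omega>' k) \<Longrightarrow> f \<omega> = f \<omega>'"
  unfolding depends_on_def by blast

lemma depends_on_not: "depends_on I E \<Longrightarrow> depends_on I (\<lambda>\<omega>. \<not> E \<omega>)"
  unfolding depends_on_def by blast

lemma prob_pair_pmf_Times:
  "measure_pmf.prob (pair_pmf M N) (A \<times> B) = measure_pmf.prob M A * measure_pmf.prob N B"
proof -
  have "measure_pmf.prob (pair_pmf M N) (A \<times> B) =
      measure_pmf.prob (pair_pmf M N) ((A \<inter> set_pmf M) \<times> (B \<inter> set_pmf N))"
    by (rule measure_prob_cong_0) (auto simp: pmf_pair set_pmf_iff)
  also have "\<dots> = measure_pmf.prob M (A \<inter> set_pmf M) * measure_pmf.prob N (B \<inter> set_pmf N)"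
    by (rule measure_pmf_prob_product) (auto intro: countable_subset[OF _ countable_set_pmf])
  finally show ?thesis by (simp add: measure_Int_set_pmf)
qed

text \<open>Splitting \<open>K\<close> into \<open>K \<inter> I\<close> and \<open>K - I\<close>
  presents the product as a pair of independent samples. \<open>A\<close> reads only the first,
  since coordinates outside \<open>K\<close> always have the value \<open>d\<close>, and
  \<open>B\<close> only the second, since \<open>J\<close> avoids \<open>I\<close>.\<close>

lemma Pi_pmf_indep:
  assumes K: "finite K" and A: "depends_on I A" and B: "depends_on J B" and IJ: "I \<inter> J = {}"
  shows "measure_pmf.prob (Pi_pmf K d q) {\<omega>. A \<omega> \<and> B \<omega>} =
    measure_pmf.prob (Pi_pmf K d q) {\<omega>. A \<omega>} * measure_pmf.prob (Pi_pmf K d q) {\<omega>. B \<omega>}"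
proof -
  define K1 where "K1 = K \<inter> I"
  define K2 where "K2 = K - I"
  let ?P1 = "Pi_pmf K1 d q" and ?P2 = "Pi_pmf K2 d q"
  let ?h = "\<lambda>(f, g). \<lambda>x. if x \<in> K1 then f x else g x"
  have fin: "finite K1" "finite K2" "K1 \<inter> K2 = {}" and K12: "K = K1 \<union> K2"
    using K by (auto simp: K1_def K2_def)
  have P: "Pi_pmf K d q = map_pmf ?h (pair_pmf ?P1 ?P2)"
    unfolding K12 by (rule Pi_pmf_union) (use fin in auto)
  have supp1: "f x = d" if "f \<in> set_pmf ?P1" "x \<notin> K1" for f x
    using set_Pi_pmf_subset[OF fin(1), of d q] that by blast
  have supp2: "f x = d" if "f \<in> set_pmf ?P2" "x \<notin> K2" for f x
    using set_Pi_pmf_subset[OF fin(2), of d q] that by blast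
  have Ah: "A (?h (f, g)) = A f" if "f \<in> set_pmf ?P1" "g \<in> set_pmf ?P2" for f g
    by (rule depends_onD[OF A]) (use supp1[OF that(1)] supp2[OF that(2)] in \<open>auto simp: K1_def K2_def\<close>)
  have Bh: "B (?h (f, g)) = B g" if "f \<in> set_pmf ?P1" "g \<in> set_pmf ?P2" for f g
    by (rule depends_onD[OF B]) (use IJ in \<open>auto simp: K1_def\<close>)
  \<comment> \<open>Used three times: for the joint event and, with one trivial factor, for each
    marginal.\<close>
  have eq: "measure_pmf.prob (Pi_pmf K d q) {\<omega>. P \<omega>} =
      measure_pmf.prob ?P1 {f. Q f} * measure_pmf.prob ?P2 {g. R g}"
    if "\<And>f g. f \<in> set_pmf ?P1 \<Longrightarrow> g \<in> set_pmf ?P2 \<Longrightarrow> P (?h (f, g)) = (Q f \<and> R g)"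
    for P Q R
  proof -
    have "measure_pmf.prob (Pi_pmf K d q) {\<omega>. P \<omega>} =
        measure_pmf.prob (pair_pmf ?P1 ?P2) (?h -` {\<omega>. P \<omega>})"
      unfolding P by (rule measure_map_pmf)
    also have "\<dots> = measure_pmf.prob (pair_pmf ?P1 ?P2) ({f. Q f} \<times> {g. R g})"
    proof (rule measure_prob_cong_0)
      fix x assume "x \<in> ?h -` {\<omega>. P \<omega>} - {f. Q f} \<times> {g. R g}"
      with that[of "fst x" "snd x"] have "x \<notin> set_pmf ?P1 \<times> set_pmf ?P2"
        by (auto simp: case_prod_unfold)
      then show "pmf (pair_pmf ?P1 ?P2) x = 0"
        by (simp add: pmf_eq_0_set_pmf)
    next
      fix x assume "x \<in> {f. Q f} \<times> {g. R g} - ?h -` {\<omega>. P \<omega>}"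
      with that[of "fst x" "snd x"] have "x \<notin> set_pmf ?P1 \<times> set_pmf ?P2"
        by (auto simp: case_prod_unfold)
      then show "pmf (pair_pmf ?P1 ?P2) x = 0"
        by (simp add: pmf_eq_0_set_pmf)
    qed
    finally show ?thesis by (simp only: prob_pair_pmf_Times)
  qed
  have "measure_pmf.prob (Pi_pmf K d q) {\<omega>. A \<omega> \<and> B \<omega>} =
      measure_pmf.prob ?P1 {f. A f} * measure_pmf.prob ?P2 {g. B g}"
    by (rule eq) (simp only: Ah Bh)
  moreover have "measure_pmf.prob (Pi_pmf K d q) {\<omega>. A \<omega>} =
      measure_pmf.prob ?P1 {f. A f} * measure_pmf.prob ?P2 {g. True}"
    by (rule eq) (simp only: Ah simp_thms)
  moreover have "measure_pmf.prob (Pi_pmf K d q) {\<omega>. B \<omega>} =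
      measure_pmf.prob ?P1 {f. True} * measure_pmf.prob ?P2 {g. B g}"
    by (rule eq) (simp only: Bh simp_thms)
  ultimately show ?thesis by simp
qed

text \<open>The exploration principle: once the coordinates in \<open>I\<close> have been revealed through \<open>f\<close>, an event
  about the coordinates in \<open>J\<close> is as likely as it was before.\<close>

lemma Pi_pmf_fresh_bound:
  fixes f :: "('k \<Rightarrow> bool) \<Rightarrow> 'b" and q :: "'k \<Rightarrow> bool pmf"
  assumes K: "finite K" and f: "depends_on I f" and E: "\<And>t. depends_on J (E t)" and IJ: "I \<inter> J = {}"
    and bound: "\<And>t. H t \<Longrightarrow> measure_pmf.prob (Pi_pmf K d q) {\<omega>. E t \<omega>} \<le> \<epsilon>" and "\<epsilon> \<ge> 0"
  shows "measure_pmf.prob (Pi_pmf K d q) {\<omega>. H (f \<omega>) \<and> E (f \<omega>) \<omega>} \<le> \<epsilon>"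
proof -
  let ?M = "Pi_pmf K d q"
  \<comment> \<open>The support is finite, so the event splits according to the finitely many values
    \<open>t\<close> of \<open>f\<close>.\<close>
  have "finite (PiE_dflt K d (\<lambda>_. UNIV :: bool set))"
    using K by (intro finite_PiE_dflt) auto
  then have finM: "finite (set_pmf ?M)"
    by (rule rev_finite_subset) (use set_Pi_pmf_subset[OF K, of d q] in \<open>auto simp: PiE_dflt_def\<close>)
  define R where "R = f ` set_pmf ?M"
  have R: "finite R" using finM by (simp add: R_def)
  have dep: "depends_on I (\<lambda>\<omega>. f \<omega> = t)" for t
    using f by (auto simp: depends_on_def)
  have "measure_pmf.prob ?M {\<omega>. H (f \<omega>) \<and> E (f \<omega>) \<omega>}
      = measure_pmf.prob ?M ({\<omega>. H (f \<omega>) \<and> E (f \<omega>) \<omega>} \<inter> set_pmf ?M)"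
    by (simp add: measure_Int_set_pmf)
  also have "\<dots> \<le> measure_pmf.prob ?M (\<Union>t\<in>{t \<in> R. H t}. {\<omega>. f \<omega> = t \<and> E t \<omega>})"
    by (intro measure_pmf.finite_measure_mono) (auto simp: R_def)
  also have "\<dots> \<le> (\<Sum>t\<in>{t \<in> R. H t}. measure_pmf.prob ?M {\<omega>. f \<omega> = t \<and> E t \<omega>})"
    using R by (intro measure_pmf.finite_measure_subadditive_finite) auto
  also have "\<dots> = (\<Sum>t\<in>{t \<in> R. H t}. measure_pmf.prob ?M {\<omega>. f \<omega> = t} * measure_pmf.prob ?M {\<omega>. E t \<omega>})"
    by (intro sum.cong refl Pi_pmf_indep[OF K dep E IJ])
  also have "\<dots> \<le> (\<Sum>t\<in>{t \<in> R. H t}. measure_pmf.prob ?M {\<omega>. f \<omega> = t} * \<epsilon>)"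
    by (intro sum_mono mult_left_mono bound) auto
  also have "\<dots> = measure_pmf.prob ?M (\<Union>t\<in>{t \<in> R. H t}. {\<omega>. f \<omega> = t}) * \<epsilon>"
    unfolding sum_distrib_right[symmetric] using R
    by (subst measure_pmf.finite_measure_finite_Union) (auto simp: disjoint_family_on_def)
  also have "\<dots> \<le> 1 * \<epsilon>"
    by (intro mult_right_mono assms) auto
  finally show ?thesis by simp
qed

lemma prob_all_False:
  fixes p :: real
  assumes "finite K" "D \<subseteq> K" "0 \<le> p" "p \<le> 1"
  shows "measure_pmf.prob (Pi_pmf K False (\<lambda>_. bernoulli_pmf p)) {\<omega>. \<forall>k\<in>D. \<not> \<omega> k} = (1 - p) ^ card D"
proof -
  let ?B = "\<lambda>k. if k \<in> D then {False} else UNIV"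
  have "{\<omega>. \<forall>k\<in>D. \<not> \<omega> k} = Pi K ?B"
    using assms(2) by (auto simp: Pi_def split: if_splits)
  then have "measure_pmf.prob (Pi_pmf K False (\<lambda>_. bernoulli_pmf p)) {\<omega>. \<forall>k\<in>D. \<not> \<omega> k}
      = (\<Prod>k\<in>K. measure_pmf.prob (bernoulli_pmf p) (?B k))"
    by (simp only: measure_Pi_pmf_Pi[OF assms(1)])
  also have "\<dots> = (\<Prod>k\<in>K. if k \<in> D then 1 - p else 1)"
    using assms by (intro prod.cong refl) (auto simp: measure_pmf_single)
  also have "\<dots> = (\<Prod>k\<in>K \<inter> D. 1 - p)"
    using assms(1) by (subst prod.inter_restrict) auto
  also have "K \<inter> D = D" using assms by auto
  finally show ?thesis by simp
qed

text \<open>The curry map is injective, so the mass functions can be compared pointwise: both are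
  the same double product, or both vanish because some value off the index set differs from
  \<open>d\<close>.\<close>

lemma Pi_pmf_Times:
  fixes A :: "'i set" and B :: "'e set" and q :: "'e \<Rightarrow> 'i \<Rightarrow> 'v pmf"
  assumes "finite A" "finite B"
  shows "Pi_pmf A (\<lambda>_. d) (\<lambda>i. Pi_pmf B d (\<lambda>e. q e i)) =
    map_pmf (\<lambda>\<omega> i e. \<omega> (e, i)) (Pi_pmf (B \<times> A) d (\<lambda>(e, i). q e i))"
proof (rule pmf_eqI)
  fix F :: "'i \<Rightarrow> 'e \<Rightarrow> 'v"
  let ?c = "\<lambda>\<omega> i e. \<omega> (e, i)" and ?q = "\<lambda>(e, i). q e i"
  let ?w = "\<lambda>(e, i). F i e"
  have "inj ?c" by (auto simp: inj_def fun_eq_iff)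
  then have "pmf (map_pmf ?c (Pi_pmf (B \<times> A) d ?q)) (?c ?w) = pmf (Pi_pmf (B \<times> A) d ?q) ?w"
    by (rule pmf_map_inj')
  also have "?c ?w = F" by simp
  also have "pmf (Pi_pmf (B \<times> A) d ?q) ?w =
      pmf (Pi_pmf A (\<lambda>_. d) (\<lambda>i. Pi_pmf B d (\<lambda>e. q e i))) F"
  proof (cases "\<forall>x. x \<notin> B \<times> A \<longrightarrow> ?w x = d")
    case True
    then have "\<forall>i. i \<notin> A \<longrightarrow> F i = (\<lambda>_. d)" "\<forall>i e. e \<notin> B \<longrightarrow> F i e = d"
      by (auto simp: fun_eq_iff)
    then have "pmf (Pi_pmf A (\<lambda>_. d) (\<lambda>i. Pi_pmf B d (\<lambda>e. q e i))) F
        = (\<Prod>i\<in>A. \<Prod>e\<in>B. pmf (q e i) (F i e))"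
      using assms by (simp add: pmf_Pi)
    also have "\<dots> = (\<Prod>e\<in>B. \<Prod>i\<in>A. pmf (q e i) (F i e))"
      by (rule prod.swap)
    also have "\<dots> = (\<Prod>x\<in>B \<times> A. pmf (?q x) (?w x))"
      by (simp add: prod.cartesian_product case_prod_unfold)
    also have "\<dots> = pmf (Pi_pmf (B \<times> A) d ?q) ?w"
      using assms True by (subst pmf_Pi) auto
    finally show ?thesis by (rule sym)
  next
    case False
    then obtain e i where ei: "e \<notin> B \<or> i \<notin> A" "F i e \<noteq> d" by auto
    have "pmf (Pi_pmf A (\<lambda>_. d) (\<lambda>i. Pi_pmf B d (\<lambda>e. q e i))) F = 0"
    proof (cases "i \<in> A")
      case True
      with ei have "pmf (Pi_pmf B d (\<lambda>e. q e i)) (F i) = 0"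
        using assms by (subst pmf_Pi) auto
      with True show ?thesis
        using assms by (subst pmf_Pi) (auto intro!: prod_zero)
    next
      case False
      with ei have "F i \<noteq> (\<lambda>_. d)" by (auto simp: fun_eq_iff)
      with False show ?thesis using assms by (subst pmf_Pi) auto
    qed
    moreover from False have "pmf (Pi_pmf (B \<times> A) d ?q) ?w = 0"
      using assms by (subst pmf_Pi) auto
    ultimately show ?thesis by simp
  qed
  finally show "pmf (Pi_pmf A (\<lambda>_. d) (\<lambda>i. Pi_pmf B d (\<lambda>e. q e i))) F =
      pmf (map_pmf ?c (Pi_pmf (B \<times> A) d ?q)) F" by simp
qed

section \<open>One independent coin per coloured edge\<close>

definition colored_edges :: "'a set \<Rightarrow> nat \<Rightarrow> ('a set \<times> nat) set" where
  "colored_edges X s = all_edges X \<times> {1..s}"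

lemma finite_colored_edges: "finite X \<Longrightarrow> finite (colored_edges X s)"
  unfolding colored_edges_def all_edges_def by auto

text \<open>In a sample \<open>\<omega>\<close>, \<open>\<omega> (e, i)\<close> says that
  \<open>e\<close> is an edge of the graph with colour \<open>i\<close>. With all randomness in one
  product, disjoint sets of coloured edges are independent.\<close>

definition edge_pmf :: "'a set \<Rightarrow> nat \<Rightarrow> real \<Rightarrow> ('a set \<times> nat \<Rightarrow> bool) pmf" where
  "edge_pmf X s p = Pi_pmf (colored_edges X s) False (\<lambda>_. bernoulli_pmf p)"

lemma random_graph_family_eq_map:
  assumes "finite X"
  shows "random_graph_family X s p =
    map_pmf (\<lambda>\<omega> i. {e \<in> all_edges X. \<omega> (e, i)}) (edge_pmf X s p)"
proof -
  have fin: "finite (all_edges X)" using assms by (auto simp: all_edges_def)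
  let ?h = "\<lambda>f. {e \<in> all_edges X. f e}"
  have "random_graph_family X s p = map_pmf (\<lambda>g. ?h \<circ> g)
      (Pi_pmf {1..s} (\<lambda>_. False) (\<lambda>i. Pi_pmf (all_edges X) False (\<lambda>_. bernoulli_pmf p)))"
    unfolding random_graph_family_def random_graph_def by (rule Pi_pmf_map) auto
  also have "Pi_pmf {1..s} (\<lambda>_. False) (\<lambda>i. Pi_pmf (all_edges X) False (\<lambda>_. bernoulli_pmf p)) =
      map_pmf (\<lambda>\<omega> i e. \<omega> (e, i)) (edge_pmf X s p)"
    using Pi_pmf_Times[of "{1..s}" "all_edges X" False "\<lambda>_ _. bernoulli_pmf p"] fin
    by (simp add: edge_pmf_def colored_edges_def case_prod_unfold)
  finally show ?thesis by (simp add: pmf.map_comp o_def)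
qed

section \<open>Coloured paths and one exploration step\<close>

text \<open>The explicit colour list lets a path be extended at either end; being rainbow becomes
  distinctness of that list.\<close>

fun cpath :: "('a set \<times> nat \<Rightarrow> bool) \<Rightarrow> 'a list \<Rightarrow> nat list \<Rightarrow> bool" where
  "cpath \<omega> [x] [] \<longleftrightarrow> True"
| "cpath \<omega> (x # y # vs) (i # cs) \<longleftrightarrow> \<omega> ({x, y}, i) \<and> cpath \<omega> (y # vs) cs"
| "cpath \<omega> _ _ \<longleftrightarrow> False"

lemma cpath_not_Nil: "cpath \<omega> vs cs \<Longrightarrow> vs \<noteq> []"
  by auto

lemma cpath_Cons:
  "cpath \<omega> vs cs \<Longrightarrow> \<omega> ({x, hd vs}, i) \<Longrightarrow> cpath \<omega> (x # vs) (i # cs)"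
  by (cases vs) auto

lemma cpath_snoc:
  "cpath \<omega> vs cs \<Longrightarrow> \<omega> ({last vs, y}, i) \<Longrightarrow> cpath \<omega> (vs @ [y]) (cs @ [i])"
  by (induction \<omega> vs cs rule: cpath.induct) auto

lemma cpath_cong:
  assumes "\<And>e i. e \<subseteq> V \<Longrightarrow> \<omega> (e, i) = \<omega>' (e, i)"
  shows "set vs \<subseteq> V \<Longrightarrow> cpath \<omega> vs cs = cpath \<omega>' vs cs"
  using assms by (induction \<omega> vs cs rule: cpath.induct) auto

lemma path_edges_Cons: "path_edges (x # y # vs) = insert {x, y} (path_edges (y # vs))"
proof -
  have "{i. Suc i < length (x # y # vs)} = insert 0 (Suc ` {i. Suc i < length (y # vs)})"
  proof (rule set_eqI)
    fix i show "i \<in> {i. Suc i < length (x # y # vs)} \<longleftrightarrow> i \<in> insert 0 (Suc ` {i. Suc i < length (y # vs)})"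
      by (cases i) auto
  qed
  moreover have "path_edges zs = (\<lambda>i. {zs ! i, zs ! Suc i}) ` {i. Suc i < length zs}" for zs :: "'a list"
    by (auto simp: path_edges_def)
  ultimately show ?thesis by (simp add: image_image)
qed

lemma path_edges_subset: "e \<in> path_edges vs \<Longrightarrow> e \<subseteq> set vs"
  unfolding path_edges_def by auto

text \<open>Distinct vertices make the edges pairwise different, so the colour list can be read as a
  function of the edge; distinct colours make it injective.\<close>

lemma cpath_coloring:
  assumes "cpath \<omega> vs cs" "distinct vs" "distinct cs"
  shows "\<exists>\<phi>. \<phi> \<in> path_edges vs \<rightarrow> set cs \<and> inj_on \<phi> (path_edges vs) \<and> (\<forall>e\<in>path_edges vs. \<omega> (e, \<phi> e))"
  using assms
proof (induction \<omega> vs cs rule: cpath.induct)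
  case (1 \<omega> x)
  then show ?case by (auto simp: path_edges_def)
next
  case (2 \<omega> x y vs i cs)
  then obtain \<phi> where \<phi>: "\<phi> \<in> path_edges (y # vs) \<rightarrow> set cs" "inj_on \<phi> (path_edges (y # vs))"
    "\<forall>e\<in>path_edges (y # vs). \<omega> (e, \<phi> e)" by auto
  have new: "{x, y} \<notin> path_edges (y # vs)"
    using path_edges_subset[of "{x, y}" "y # vs"] 2(3) by auto
  let ?\<phi> = "\<phi>({x, y} := i)"
  have "?\<phi> \<in> path_edges (x # y # vs) \<rightarrow> set (i # cs)"
    using \<phi>(1) new by (auto simp: path_edges_Cons Pi_iff)
  moreover have "inj_on ?\<phi> (path_edges (x # y # vs))"
    unfolding path_edges_Cons inj_on_insert
  proof (intro conjI)
    have "\<forall>e\<in>path_edges (y # vs). ?\<phi> e = \<phi> e" using new by auto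
    then show "inj_on ?\<phi> (path_edges (y # vs))"
      using \<phi>(2) inj_on_cong[of "path_edges (y # vs)" ?\<phi> \<phi>] by simp
    show "?\<phi> {x, y} \<notin> ?\<phi> ` (path_edges (y # vs) - {{x, y}})"
      using \<phi>(1) 2(4) new by (auto simp: Pi_iff image_iff)
  qed
  moreover have "\<forall>e\<in>path_edges (x # y # vs). \<omega> (e, ?\<phi> e)"
    using \<phi>(3) 2(2) by (auto simp: path_edges_Cons)
  ultimately show ?case by blast
qed auto

lemma rainbow_path_if_cpath:
  assumes "cpath \<omega> vs cs" "distinct vs" "distinct cs" "set vs \<subseteq> X" "set cs \<subseteq> {1..s}"
  shows "rainbow_path s (\<lambda>i. {e \<in> all_edges X. \<omega> (e, i)}) vs"
proof -
  obtain \<phi> where \<phi>: "\<phi> \<in> path_edges vs \<rightarrow> set cs" "inj_on \<phi> (path_edges vs)"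
    "\<forall>e\<in>path_edges vs. \<omega> (e, \<phi> e)"
    using cpath_coloring[OF assms(1-3)] by blast
  have "path_edges vs \<subseteq> all_edges X"
  proof
    fix e assume e: "e \<in> path_edges vs"
    then obtain i where "e = {vs ! i, vs ! Suc i}" "Suc i < length vs"
      unfolding path_edges_def by blast
    then have "card e = 2"
      using assms(2) by (simp add: nth_eq_iff_index_eq)
    with path_edges_subset[OF e] assms(4) show "e \<in> all_edges X"
      by (auto simp: all_edges_def)
  qed
  with \<phi> assms(5) show ?thesis
    unfolding rainbow_path_def by (intro conjI exI[of _ \<phi>]) (fastforce simp: Pi_iff)+
qed

section \<open>One exploration step and its lower tail\<close>

definition hits :: "('a set \<times> nat \<Rightarrow> bool) \<Rightarrow> 'a set \<Rightarrow> ('a \<Rightarrow> nat set) \<Rightarrow> 'a set \<Rightarrow> 'a set" where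
  "hits \<omega> T C U = {y \<in> U. \<exists>x\<in>T. \<exists>i\<in>C x. \<omega> ({x, y}, i)}"

lemma depends_on_hits: "depends_on {({x, y}, i) | x y i. x \<in> T \<and> y \<in> U} (\<lambda>\<omega>. hits \<omega> T C U)"
proof (rule depends_onI)
  fix \<omega> \<omega>' :: "'a set \<times> nat \<Rightarrow> bool"
  assume "\<And>k. k \<in> {({x, y}, i) | x y i. x \<in> T \<and> y \<in> U} \<Longrightarrow> \<omega> k = \<omega>' k"
  then have "\<omega> ({x, y}, i) = \<omega>' ({x, y}, i)" if "x \<in> T" "y \<in> U" for x y i
    using that by blast
  then show "hits \<omega> T C U = hits \<omega>' T C U"
    unfolding hits_def by (intro Collect_cong conj_cong refl bex_cong) auto
qed

locale colored_random_graph =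
  fixes X :: "'a set" and s :: nat and p :: real
  assumes finite_X: "finite X" and p_nonneg: "0 \<le> p" and p_le_1: "p \<le> 1"
begin

abbreviation Pr :: "(('a set \<times> nat \<Rightarrow> bool) \<Rightarrow> bool) \<Rightarrow> real" where
  "Pr E \<equiv> measure_pmf.prob (edge_pmf X s p) {\<omega>. E \<omega>}"

lemma Pr_indep:
  assumes "depends_on I A" "depends_on J B" "I \<inter> J = {}"
  shows "Pr (\<lambda>\<omega>. A \<omega> \<and> B \<omega>) = Pr A * Pr B"
  unfolding edge_pmf_def by (rule Pi_pmf_indep[OF finite_colored_edges[OF finite_X] assms])

lemma Pr_fresh_bound:
  assumes "depends_on I f" "\<And>t. depends_on J (E t)" "I \<inter> J = {}"
    and "\<And>t. H t \<Longrightarrow> Pr (E t) \<le> \<epsilon>" "\<epsilon> \<ge> 0"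
  shows "Pr (\<lambda>\<omega>. H (f \<omega>) \<and> E (f \<omega>) \<omega>) \<le> \<epsilon>"
  using assms(4,5) unfolding edge_pmf_def
  by (intro Pi_pmf_fresh_bound[OF finite_colored_edges[OF finite_X] assms(1-3)])

lemma Pr_mono: "(\<And>\<omega>. A \<omega> \<Longrightarrow> B \<omega>) \<Longrightarrow> Pr A \<le> Pr B"
  by (intro measure_pmf.finite_measure_mono) auto

lemma Pr_disj: "Pr (\<lambda>\<omega>. A \<omega> \<or> B \<omega>) \<le> Pr A + Pr B"
proof -
  have "Pr (\<lambda>\<omega>. A \<omega> \<or> B \<omega>) = measure_pmf.prob (edge_pmf X s p) ({\<omega>. A \<omega>} \<union> {\<omega>. B \<omega>})"
    by (rule arg_cong[where f = "measure_pmf.prob _"]) auto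
  then show ?thesis
    using measure_Un_le[of "{\<omega>. A \<omega>}" "edge_pmf X s p" "{\<omega>. B \<omega>}"] by simp
qed

lemma Pr_Bex:
  assumes "finite S" "\<And>x. x \<in> S \<Longrightarrow> Pr (A x) \<le> \<epsilon>"
  shows "Pr (\<lambda>\<omega>. \<exists>x\<in>S. A x \<omega>) \<le> real (card S) * \<epsilon>"
proof -
  have "Pr (\<lambda>\<omega>. \<exists>x\<in>S. A x \<omega>) = measure_pmf.prob (edge_pmf X s p) (\<Union>x\<in>S. {\<omega>. A x \<omega>})"
    by (rule arg_cong[where f = "measure_pmf.prob _"]) auto
  also have "\<dots> \<le> (\<Sum>x\<in>S. Pr (A x))"
    using assms(1) by (intro measure_pmf.finite_measure_subadditive_finite) auto
  also have "\<dots> \<le> (\<Sum>x\<in>S. \<epsilon>)"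
    by (intro sum_mono assms)
  finally show ?thesis by simp
qed

lemma Pr_compl: "Pr (\<lambda>\<omega>. \<not> A \<omega>) = 1 - Pr A"
proof -
  have "{\<omega>. \<not> A \<omega>} = UNIV - {\<omega>. A \<omega>}" by auto
  then show ?thesis
    using measure_pmf.prob_compl[of "{\<omega>. A \<omega>}" "edge_pmf X s p"] by simp
qed

lemma Pr_no_edge:
  assumes "D \<subseteq> colored_edges X s"
  shows "Pr (\<lambda>\<omega>. \<forall>k\<in>D. \<not> \<omega> k) = (1 - p) ^ card D"
  unfolding edge_pmf_def
  by (rule prob_all_False[OF finite_colored_edges[OF finite_X] assms p_nonneg p_le_1])

text \<open>Because \<open>y\<close> lies outside \<open>T\<close>, different pairs
  \<open>(x, i)\<close> refer to different coins.\<close>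

lemma Pr_not_hit:
  assumes "y \<in> X" "T \<subseteq> X" "y \<notin> T" "\<And>x. x \<in> T \<Longrightarrow> C x \<subseteq> {1..s}"
  shows "Pr (\<lambda>\<omega>. \<not> (\<exists>x\<in>T. \<exists>i\<in>C x. \<omega> ({x, y}, i))) = (1 - p) ^ (\<Sum>x\<in>T. card (C x))"
proof -
  define D where "D = (\<lambda>(x, i). ({x, y}, i)) ` (SIGMA x:T. C x)"
  have "inj_on (\<lambda>(x, i). ({x, y}, i)) (SIGMA x:T. C x)"
    using assms(3) by (auto simp: inj_on_def doubleton_eq_iff)
  then have "card D = card (SIGMA x:T. C x)"
    unfolding D_def by (rule card_image)
  also have "\<dots> = (\<Sum>x\<in>T. card (C x))"
    using finite_subset[OF assms(2) finite_X] assms(4) finite_subset[OF assms(4)]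
    by (subst card_SigmaI) auto
  finally have "card D = (\<Sum>x\<in>T. card (C x))" .
  moreover have "D \<subseteq> colored_edges X s"
  proof
    fix k assume "k \<in> D"
    then obtain x i where "k = ({x, y}, i)" "x \<in> T" "i \<in> C x" by (auto simp: D_def)
    moreover from this have "x \<noteq> y" "x \<in> X" "i \<in> {1..s}" using assms(2,3) assms(4)[of x] by blast+
    ultimately show "k \<in> colored_edges X s"
      using assms(1) by (simp add: colored_edges_def all_edges_def)
  qed
  ultimately have "Pr (\<lambda>\<omega>. \<forall>k\<in>D. \<not> \<omega> k) = (1 - p) ^ (\<Sum>x\<in>T. card (C x))"
    using Pr_no_edge by simp
  moreover have "(\<forall>k\<in>D. \<not> \<omega> k) \<longleftrightarrow> \<not> (\<exists>x\<in>T. \<exists>i\<in>C x. \<omega> ({x, y}, i))" for \<omega>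
    unfolding D_def by auto
  ultimately show ?thesis by simp
qed

text \<open>The Chernoff lower tail, by induction over \<open>U\<close>. Each vertex is hit
  independently with probability at least \<open>1 - (1 - p) ^ D\<close>, and the base of the power
  is the mean of \<open>exp (- \<theta> * B)\<close> for a Bernoulli variable \<open>B\<close> with
  this success probability.\<close>

lemma hits_tail:
  assumes "T \<subseteq> X" "\<And>x. x \<in> T \<Longrightarrow> C x \<subseteq> {1..s}" "D \<le> (\<Sum>x\<in>T. card (C x))" "\<theta> \<ge> 0"
    and "finite U" "U \<subseteq> X - T"
  shows "Pr (\<lambda>\<omega>. card (hits \<omega> T C U) < N)
    \<le> exp (\<theta> * real N) * (1 - (1 - (1 - p) ^ D) * (1 - exp (- \<theta>))) ^ card U"
  using assms(5,6)
proof (induction U arbitrary: N rule: finite_induct)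
  case empty
  then show ?case
    using assms(4) by (auto intro: order_trans[OF measure_pmf.prob_le_1])
next
  case (insert y U)
  define \<beta> where "\<beta> = 1 - (1 - (1 - p) ^ D) * (1 - exp (- \<theta>))"
  define q where "q = (1 - p) ^ (\<Sum>x\<in>T. card (C x))"
  have q: "0 \<le> q" "q \<le> (1 - p) ^ D" "(1 - p) ^ D \<le> 1"
    using p_nonneg p_le_1 assms(3) by (auto simp: q_def power_decreasing power_le_one)
  have e: "exp (- \<theta>) \<le> 1" "0 \<le> exp (- \<theta>)" using assms(4) by auto
  have \<beta>: "0 \<le> \<beta>" using q e unfolding \<beta>_def by (simp add: mult_le_one)
  show ?case
  proof (cases N)
    case 0
    then show ?thesis using \<beta> by (simp add: \<beta>_def)
  next
    case (Suc N')
    let ?A = "\<lambda>\<omega>. \<not> (\<exists>x\<in>T. \<exists>i\<in>C x. \<omega> ({x, y}, i))"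
    let ?B = "\<lambda>N \<omega>. card (hits \<omega> T C U) < N"
    let ?I = "{({x, y}, i) | x i. x \<in> T}" and ?J = "{({x, y}, i) | x y i. x \<in> T \<and> y \<in> U}"
    have depA: "depends_on ?I ?A"
    proof (rule depends_onI)
      fix \<omega> \<omega>' :: "'a set \<times> nat \<Rightarrow> bool"
      assume "\<And>k. k \<in> ?I \<Longrightarrow> \<omega> k = \<omega>' k"
      then have "\<omega> ({x, y}, i) = \<omega>' ({x, y}, i)" if "x \<in> T" for x i
        using that by blast
      then show "?A \<omega> = ?A \<omega>'" by simp
    qed
    have depB: "depends_on ?J (?B N)" for N
    proof (rule depends_onI)
      fix \<omega> \<omega>' :: "'a set \<times> nat \<Rightarrow> bool"
      assume "\<And>k. k \<in> ?J \<Longrightarrow> \<omega> k = \<omega>' k"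
      then have "hits \<omega> T C U = hits \<omega>' T C U"
        by (rule depends_onD[OF depends_on_hits])
      then show "?B N \<omega> = ?B N \<omega>'" by simp
    qed
    have disj: "?I \<inter> ?J = {}"
      using insert.hyps insert.prems by (auto simp: doubleton_eq_iff)
    have fin: "finite (hits \<omega> T C U)" for \<omega>
      using insert.hyps by (simp add: hits_def)
    have hI: "hits \<omega> T C (insert y U) = (if ?A \<omega> then hits \<omega> T C U else insert y (hits \<omega> T C U))" for \<omega>
      by (auto simp: hits_def)
    have "y \<notin> hits \<omega> T C U" for \<omega> using insert.hyps by (auto simp: hits_def)
    \<comment> \<open>If \<open>y\<close> is missed, \<open>U\<close> must supply fewer than
      \<open>N\<close> hits; if it is hit, fewer than \<open>N' = N - 1\<close>.\<close>
    with fin hI have split: "card (hits \<omega> T C (insert y U)) < N \<longleftrightarrow>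
        (?A \<omega> \<and> ?B N \<omega>) \<or> (\<not> ?A \<omega> \<and> ?B N' \<omega>)" for \<omega>
      using Suc by (cases "?A \<omega>") (simp_all, auto)
    have PA: "Pr ?A = q"
      unfolding q_def using insert.prems assms(1,2) by (intro Pr_not_hit) auto
    have "Pr (\<lambda>\<omega>. card (hits \<omega> T C (insert y U)) < N)
        \<le> Pr (\<lambda>\<omega>. ?A \<omega> \<and> ?B N \<omega>) + Pr (\<lambda>\<omega>. \<not> ?A \<omega> \<and> ?B N' \<omega>)"
      unfolding split by (rule Pr_disj)
    also have "Pr (\<lambda>\<omega>. ?A \<omega> \<and> ?B N \<omega>) = q * Pr (?B N)"
      using Pr_indep[OF depA depB disj] PA by simp
    also have "Pr (\<lambda>\<omega>. \<not> ?A \<omega> \<and> ?B N' \<omega>) = (1 - q) * Pr (?B N')"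
      using Pr_indep[OF depends_on_not[OF depA] depB disj] PA Pr_compl[of ?A] by simp
    also have "q * Pr (?B N) + (1 - q) * Pr (?B N')
        \<le> q * (exp (\<theta> * real N) * \<beta> ^ card U) + (1 - q) * (exp (\<theta> * real N') * \<beta> ^ card U)"
      using q insert unfolding \<beta>_def by (intro add_mono mult_left_mono) auto
    also have "\<dots> = exp (\<theta> * real N) * \<beta> ^ card U * (1 - (1 - q) * (1 - exp (- \<theta>)))"
    proof -
      have "exp (\<theta> * real N') = exp (\<theta> * real N) * exp (- \<theta>)"
        unfolding Suc exp_add[symmetric] by (simp add: algebra_simps)
      then show ?thesis by (simp add: algebra_simps)
    qed
    also have "\<dots> \<le> exp (\<theta> * real N) * \<beta> ^ card U * \<beta>"
    proof -
      have "(1 - (1 - p) ^ D) * (1 - exp (- \<theta>)) \<le> (1 - q) * (1 - exp (- \<theta>))"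
        using q e by (intro mult_right_mono) auto
      then have "1 - (1 - q) * (1 - exp (- \<theta>)) \<le> \<beta>" by (simp add: \<beta>_def)
      then show ?thesis using \<beta> by (intro mult_left_mono) auto
    qed
    also have "\<dots> = exp (\<theta> * real N) * \<beta> ^ card (insert y U)"
      using insert.hyps by simp
    finally show ?thesis unfolding \<beta>_def .
  qed
qed

lemma hits_tail_exp:
  assumes "T \<subseteq> X" "\<And>x. x \<in> T \<Longrightarrow> C x \<subseteq> {1..s}" "D \<le> (\<Sum>x\<in>T. card (C x))" "\<theta> \<ge> 0"
    and "U \<subseteq> X - T" "m \<le> card U"
  shows "Pr (\<lambda>\<omega>. card (hits \<omega> T C U) < N)
    \<le> exp (\<theta> * real N - real m * (1 - exp (- (p * real D))) * (1 - exp (- \<theta>)))"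
proof -
  have finU: "finite U" using assms(5) finite_X finite_subset by blast
  have "(1 - p) ^ D \<le> exp (- p) ^ D"
    using p_le_1 exp_ge_add_one_self[of "- p"] by (intro power_mono) auto
  also have "\<dots> = exp (- (p * real D))"
    by (simp add: exp_of_nat_mult[symmetric] algebra_simps)
  finally have pD: "(1 - p) ^ D \<le> exp (- (p * real D))" .
  have pD1: "exp (- (p * real D)) \<le> 1" using p_nonneg by simp
  have e: "exp (- \<theta>) \<le> 1" "0 \<le> exp (- \<theta>)" using assms(4) by auto
  define z where "z = (1 - (1 - p) ^ D) * (1 - exp (- \<theta>))"
  define z' where "z' = (1 - exp (- (p * real D))) * (1 - exp (- \<theta>))"
  have "z' \<le> z" unfolding z_def z'_def using pD e by (intro mult_right_mono) auto
  have z1: "z \<le> 1" "0 \<le> z'"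
    using e pD1 p_le_1 by (auto simp: z_def z'_def mult_le_one)
  have "(1 - z) ^ card U \<le> exp (- z') ^ card U"
    using z1 \<open>z' \<le> z\<close> exp_ge_add_one_self[of "- z'"] by (intro power_mono) auto
  also have "\<dots> = exp (- (real (card U) * z'))"
    by (simp add: exp_of_nat_mult[symmetric])
  also have "\<dots> \<le> exp (- (real m * z'))"
    using assms(6) z1 by (auto intro: mult_right_mono)
  finally have "exp (\<theta> * real N) * (1 - z) ^ card U \<le> exp (\<theta> * real N) * exp (- (real m * z'))"
    by simp
  also have "\<dots> = exp (\<theta> * real N - real m * z')" by (simp add: exp_diff exp_minus divide_inverse)
  finally show ?thesis
    using hits_tail[OF assms(1-4) finU assms(5), of N] by (simp add: z_def z'_def mult.assoc)
qed

end

section \<open>Growing a rainbow exploration\<close>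

text \<open>\<open>C x\<close> is the set of colours available to paths that start at \<open>x \<in> T\<close>.\<close>

definition cpath_from ::
  "('a set \<times> nat \<Rightarrow> bool) \<Rightarrow> 'a set \<Rightarrow> 'a set \<Rightarrow> ('a \<Rightarrow> nat set) \<Rightarrow> nat \<Rightarrow> 'a list \<Rightarrow> nat list \<Rightarrow> bool" where
  "cpath_from \<omega> V T C j vs cs \<longleftrightarrow> cpath \<omega> vs cs \<and> hd vs \<in> T \<and> distinct vs \<and> set vs \<subseteq> V \<and>
     distinct cs \<and> set cs \<subseteq> C (hd vs) \<and> length cs = j"

text \<open>Ends of paths with exactly \<open>j\<close> edges, not vertices at distance
  \<open>j\<close>: the exact length fixes the number of spent colours.\<close>

definition reached ::
  "('a set \<times> nat \<Rightarrow> bool) \<Rightarrow> 'a set \<Rightarrow> 'a set \<Rightarrow> ('a \<Rightarrow> nat set) \<Rightarrow> nat \<Rightarrow> 'a set" where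
  "reached \<omega> V T C j = {y. \<exists>vs cs. cpath_from \<omega> V T C j vs cs \<and> last vs = y}"

lemma cpath_from_cong:
  assumes "\<And>e i. e \<subseteq> V \<Longrightarrow> \<omega> (e, i) = \<omega>' (e, i)"
  shows "cpath_from \<omega> V T C j vs cs = cpath_from \<omega>' V T C j vs cs"
  unfolding cpath_from_def using cpath_cong[of V \<omega> \<omega>' vs cs] assms by blast

lemma reached_cong:
  assumes "\<And>e i. e \<subseteq> V \<Longrightarrow> \<omega> (e, i) = \<omega>' (e, i)"
  shows "reached \<omega> V T C j = reached \<omega>' V T C j"
  unfolding reached_def using cpath_from_cong[of V \<omega> \<omega>'] assms by blast

lemma reached_subset: "reached \<omega> V T C j \<subseteq> V"
  using last_in_set cpath_not_Nil unfolding reached_def cpath_from_def by blast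

lemma reached_0: "T \<subseteq> V \<Longrightarrow> T \<subseteq> reached \<omega> V T C 0"
proof
  fix x assume "T \<subseteq> V" "x \<in> T"
  then have "cpath_from \<omega> V T C 0 [x] []" by (auto simp: cpath_from_def)
  then show "x \<in> reached \<omega> V T C 0" by (force simp: reached_def)
qed

text \<open>Recursion at the front of the path. Deleting \<open>T\<close> from \<open>V\<close>
  keeps the vertices distinct, and deleting \<open>i\<close> from the colours of \<open>x\<close>
  keeps the colours distinct.\<close>

lemma reached_Suc:
  assumes "T \<subseteq> V"
    and "\<And>y. y \<in> T' \<Longrightarrow> \<exists>x\<in>T. \<exists>i\<in>C x. \<omega> ({x, y}, i) \<and> C' y = C x - {i}"
  shows "reached \<omega> (V - T) T' C' j \<subseteq> reached \<omega> V T C (Suc j)"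
proof
  fix z assume "z \<in> reached \<omega> (V - T) T' C' j"
  then obtain vs cs where path: "cpath_from \<omega> (V - T) T' C' j vs cs" "last vs = z"
    unfolding reached_def by blast
  then obtain x i where xi: "x \<in> T" "i \<in> C x" "\<omega> ({x, hd vs}, i)" "C' (hd vs) = C x - {i}"
    using assms(2) unfolding cpath_from_def by blast
  then have "cpath_from \<omega> V T C (Suc j) (x # vs) (i # cs)"
    using path(1) assms(1) unfolding cpath_from_def by (auto intro: cpath_Cons)
  moreover have "last (x # vs) = z"
    using path cpath_not_Nil unfolding cpath_from_def by auto
  ultimately show "z \<in> reached \<omega> V T C (Suc j)"
    unfolding reached_def by blast
qed

context colored_random_graph
begin

text \<open>\<open>N k\<close> is the prescribed size of level \<open>k\<close>, \<open>m k\<close>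
  bounds from below the vertices left after it, and \<open>r - k\<close> the colours still available
  to each of its vertices. The induction reveals the edges from \<open>T\<close> to the rest, keeps
  exactly \<open>N 1\<close> of the vertices hit and restarts from them in \<open>V - T\<close>,
  whose inner edges are still fresh.\<close>

lemma growth:
  assumes "\<And>k. k < j \<Longrightarrow> 0 \<le> \<theta> k"
    and "\<And>k. k < j \<Longrightarrow> exp (\<theta> k * real (N (Suc k)) - real (m k) * (1 - exp (- (p * real (N k * (r - k)))))
           * (1 - exp (- \<theta> k))) \<le> \<epsilon>"
    and "\<And>k. k < j \<Longrightarrow> N (Suc k) + m (Suc k) \<le> m k"
    and "\<epsilon> \<ge> 0"
    and "T \<subseteq> V" "V \<subseteq> X" "card T = N 0" "N 0 + m 0 \<le> card V"
    and "\<And>x. x \<in> T \<Longrightarrow> C x \<subseteq> {1..s} \<and> r \<le> card (C x)"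
  shows "Pr (\<lambda>\<omega>. card (reached \<omega> V T C j) < N j) \<le> real j * \<epsilon>"
  using assms
proof (induction j arbitrary: \<theta> N m r T V C)
  case 0
  have "N 0 \<le> card (reached \<omega> V T C 0)" for \<omega>
    using card_mono[OF finite_subset[OF reached_subset] reached_0[OF 0(5)]] finite_subset[OF 0(6) finite_X] 0(7)
    by metis
  then show ?case by (simp add: leD)
next
  case (Suc j)
  have finV: "finite V" using Suc.prems(6) finite_X finite_subset by blast
  then have finT: "finite T" using Suc.prems(5) finite_subset by blast
  define U where "U = V - T"
  \<comment> \<open>\<open>R \<omega>\<close> is all that the first step reveals. The choices below
    are functions of it alone: \<open>T'\<close> the vertices kept, \<open>pr\<close> a parent with
    the joining colour, \<open>C'\<close> the colours left.\<close>
  define R where "R = (\<lambda>\<omega>. {(x, y, i). x \<in> T \<and> y \<in> U \<and> i \<in> C x \<and> \<omega> ({x, y}, i)})"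
  define HH where "HH = (\<lambda>t :: ('a \<times> 'a \<times> nat) set. {y. \<exists>x i. (x, y, i) \<in> t})"
  define H where "H = (\<lambda>t. t \<subseteq> {(x, y, i). x \<in> T \<and> y \<in> U \<and> i \<in> C x} \<and> N 1 \<le> card (HH t))"
  define T' where "T' = (\<lambda>t. SOME S. S \<subseteq> HH t \<and> card S = N 1)"
  define pr where "pr = (\<lambda>(t :: ('a \<times> 'a \<times> nat) set) y. SOME q. (fst q, y, snd q) \<in> t)"
  define C' where "C' = (\<lambda>t y. C (fst (pr t y)) - {snd (pr t y)})"
  define E where "E = (\<lambda>t \<omega>. card (reached \<omega> U (T' t) (C' t) j) < N (Suc j))"
  have T': "T' t \<subseteq> HH t" "card (T' t) = N 1" if "H t" for t
  proof -
    have "\<exists>S. S \<subseteq> HH t \<and> card S = N 1"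
      using that obtain_subset_with_card_n[of "N 1" "HH t"] unfolding H_def by metis
    from someI_ex[OF this] show "T' t \<subseteq> HH t" "card (T' t) = N 1" unfolding T'_def by auto
  qed
  have pr: "(fst (pr t y), y, snd (pr t y)) \<in> t" if "y \<in> HH t" for t y
  proof -
    from that obtain x i where "(x, y, i) \<in> t" unfolding HH_def by blast
    then have "(fst (x, i), y, snd (x, i)) \<in> t" by simp
    then show ?thesis unfolding pr_def by (rule someI)
  qed
  have HHR: "HH (R \<omega>) = hits \<omega> T C U" for \<omega>
    unfolding HH_def R_def hits_def by auto
  \<comment> \<open>The schedule is shifted by one level; \<open>r - 1\<close> accounts for the
    colour of the first edge.\<close>
  have PE: "Pr (E t) \<le> real j * \<epsilon>" if "H t" for t
    unfolding E_def
  proof (rule Suc.IH[where \<theta> = "\<lambda>k. \<theta> (Suc k)" and N = "\<lambda>k. N (Suc k)" and m = "\<lambda>k. m (Suc k)" and r = "r - 1"])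
    show "T' t \<subseteq> U"
      using T'(1)[OF that] that unfolding H_def HH_def by blast
    show "U \<subseteq> X" using Suc.prems(6) U_def by blast
    show "card (T' t) = N (Suc 0)" using T'(2)[OF that] by simp
    have "card U = card V - N 0"
      unfolding U_def using finT Suc.prems(5,7) by (simp add: card_Diff_subset)
    then show "N (Suc 0) + m (Suc 0) \<le> card U"
      using Suc.prems(3)[of 0] Suc.prems(8) by simp
    show "C' t x \<subseteq> {1..s} \<and> r - 1 \<le> card (C' t x)" if "x \<in> T' t" for x
    proof -
      have "(fst (pr t x), x, snd (pr t x)) \<in> t"
        using that T'(1)[OF \<open>H t\<close>] pr by blast
      then have "fst (pr t x) \<in> T" "snd (pr t x) \<in> C (fst (pr t x))"
        using \<open>H t\<close> unfolding H_def by auto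
      with Suc.prems(9) show ?thesis
        unfolding C'_def by (auto simp: card_Diff_singleton_if intro: diff_le_mono)
    qed
    show "exp (\<theta> (Suc k) * real (N (Suc (Suc k))) - real (m (Suc k)) *
        (1 - exp (- (p * real (N (Suc k) * (r - 1 - k))))) * (1 - exp (- \<theta> (Suc k)))) \<le> \<epsilon>"
      if "k < j" for k
      using Suc.prems(2)[of "Suc k"] that by simp
  qed (use Suc.prems in auto)
  have "depends_on {({x, y}, i) | x y i. x \<in> T \<and> y \<in> U} R"
  proof (rule depends_onI)
    fix \<omega> \<omega>' :: "'a set \<times> nat \<Rightarrow> bool"
    assume "\<And>k. k \<in> {({x, y}, i) | x y i. x \<in> T \<and> y \<in> U} \<Longrightarrow> \<omega> k = \<omega>' k"
    then have "\<omega> ({x, y}, i) = \<omega>' ({x, y}, i)" if "x \<in> T" "y \<in> U" for x y i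
      using that by blast
    then show "R \<omega> = R \<omega>'" unfolding R_def by auto
  qed
  moreover have "depends_on {(e, i). e \<subseteq> U} (E t)" for t
  proof (rule depends_onI)
    fix \<omega> \<omega>' :: "'a set \<times> nat \<Rightarrow> bool"
    assume "\<And>k. k \<in> {(e, i). e \<subseteq> U} \<Longrightarrow> \<omega> k = \<omega>' k"
    then show "E t \<omega> = E t \<omega>'"
      unfolding E_def using reached_cong[of U \<omega> \<omega>'] by simp
  qed
  \<comment> \<open>\<open>R\<close> reads only edges from \<open>T\<close> to \<open>U\<close>, and
    \<open>E t\<close> only edges inside \<open>U\<close>.\<close>
  ultimately have P2: "Pr (\<lambda>\<omega>. H (R \<omega>) \<and> E (R \<omega>) \<omega>) \<le> real j * \<epsilon>"
    by (rule Pr_fresh_bound) (use PE Suc.prems(4) in \<open>auto simp: U_def\<close>)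
  have "N 0 * r \<le> (\<Sum>x\<in>T. card (C x))"
    using sum_mono[of T "\<lambda>_. r" "\<lambda>x. card (C x)"] Suc.prems(7,9) by simp
  moreover have "m 0 \<le> card U"
    unfolding U_def using finT Suc.prems(5,7,8) by (simp add: card_Diff_subset)
  ultimately have "Pr (\<lambda>\<omega>. card (hits \<omega> T C U) < N 1)
      \<le> exp (\<theta> 0 * real (N 1) - real (m 0) * (1 - exp (- (p * real (N 0 * r)))) * (1 - exp (- \<theta> 0)))"
    using Suc.prems(1,5,6,9) by (intro hits_tail_exp) (auto simp: U_def)
  also have "\<dots> \<le> \<epsilon>" using Suc.prems(2)[of 0] by simp
  finally have P1: "Pr (\<lambda>\<omega>. card (hits \<omega> T C U) < N 1) \<le> \<epsilon>" .
  have "Pr (\<lambda>\<omega>. card (reached \<omega> V T C (Suc j)) < N (Suc j))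
      \<le> Pr (\<lambda>\<omega>. card (hits \<omega> T C U) < N 1 \<or> (H (R \<omega>) \<and> E (R \<omega>) \<omega>))"
  proof (rule Pr_mono)
    fix \<omega> assume few: "card (reached \<omega> V T C (Suc j)) < N (Suc j)"
    show "card (hits \<omega> T C U) < N 1 \<or> (H (R \<omega>) \<and> E (R \<omega>) \<omega>)"
    proof (cases "card (hits \<omega> T C U) < N 1")
      case False
      then have H: "H (R \<omega>)" unfolding H_def HHR by (auto simp: R_def)
      have "reached \<omega> (V - T) (T' (R \<omega>)) (C' (R \<omega>)) j \<subseteq> reached \<omega> V T C (Suc j)"
      proof (rule reached_Suc[OF Suc.prems(5)])
        fix y assume "y \<in> T' (R \<omega>)"
        then have "(fst (pr (R \<omega>) y), y, snd (pr (R \<omega>) y)) \<in> R \<omega>"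
          using T'(1)[OF H] pr by blast
        then have "fst (pr (R \<omega>) y) \<in> T" "snd (pr (R \<omega>) y) \<in> C (fst (pr (R \<omega>) y))"
          "\<omega> ({fst (pr (R \<omega>) y), y}, snd (pr (R \<omega>) y))"
          by (simp_all add: R_def)
        then show "\<exists>x\<in>T. \<exists>i\<in>C x. \<omega> ({x, y}, i) \<and> C' (R \<omega>) y = C x - {i}"
          unfolding C'_def by blast
      qed
      then have "card (reached \<omega> U (T' (R \<omega>)) (C' (R \<omega>)) j) \<le> card (reached \<omega> V T C (Suc j))"
        unfolding U_def by (intro card_mono finite_subset[OF reached_subset finV])
      with few H show ?thesis unfolding E_def by simp
    qed simp
  qed
  also have "\<dots> \<le> \<epsilon> + real j * \<epsilon>"
    using Pr_disj[of "\<lambda>\<omega>. card (hits \<omega> T C U) < N 1" "\<lambda>\<omega>. H (R \<omega>) \<and> E (R \<omega>) \<omega>"] P1 P2 by linarith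
  finally show ?case by (simp add: algebra_simps)
qed

end

section \<open>Joining two vertices\<close>

context colored_random_graph
begin

text \<open>Excluding a single colour \<open>j\<close> leaves room for the last edge of the path, which will be coloured \<open>j\<close>.\<close>

definition good_degree :: "nat \<Rightarrow> 'a \<Rightarrow> ('a set \<times> nat \<Rightarrow> bool) \<Rightarrow> bool" where
  "good_degree M u \<omega> \<longleftrightarrow>
     (\<forall>j\<in>{1..s}. 2 * M + 1 \<le> card (hits \<omega> {u} (\<lambda>_. {1..s} - {j}) (X - {u})))"

text \<open>Here \<open>t\<close> records the edges at \<open>u\<close> and \<open>v\<close>, which are revealed first, and \<open>\<omega>\<close> all other edges.\<close>

definition linked :: "'a \<Rightarrow> 'a \<Rightarrow> ('a set \<times> nat \<Rightarrow> bool) \<Rightarrow> ('a set \<times> nat \<Rightarrow> bool) \<Rightarrow> bool" where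
  "linked u v t \<omega> \<longleftrightarrow> (\<exists>i vs cs j. t ({u, hd vs}, i) \<and> t ({last vs, v}, j) \<and> cpath \<omega> vs cs \<and>
     distinct (i # j # cs) \<and> distinct vs \<and> set vs \<subseteq> X - {u, v} \<and> set (i # j # cs) \<subseteq> {1..s})"

text \<open>Two exposures with \<open>t\<close> fixed. The edges inside \<open>W\<close>, which
  avoids \<open>u\<close>, \<open>v\<close> and chosen neighbours \<open>Sv\<close> of
  \<open>v\<close>, carry one exploration for each colour reserved for a last edge. The edges from
  the final level to \<open>Sv\<close> are then still fresh, and all suitable ones must be absent
  for the connection to fail.\<close>

lemma linked_failure:
  assumes uv: "u \<in> X" "v \<in> X" "u \<noteq> v"
    and good: "good_degree M u t" "good_degree M v t"
    and "s \<ge> 1" "\<epsilon> \<ge> 0"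
    and steps: "\<And>k. k < J \<Longrightarrow> 0 \<le> \<theta> k"
      "\<And>k. k < J \<Longrightarrow> exp (\<theta> k * real (N (Suc k)) - real (m k) * (1 - exp (- (p * real (N k * (s - 2 - k)))))
           * (1 - exp (- \<theta> k))) \<le> \<epsilon>"
      "\<And>k. k < J \<Longrightarrow> N (Suc k) + m (Suc k) \<le> m k"
    and "N 0 = M" "2 * M + m 0 + 2 \<le> card X"
  shows "Pr (\<lambda>\<omega>. \<not> linked u v t \<omega>) \<le> real M * (real J * \<epsilon>) + (1 - p) ^ (M * N J * (s - 2 - J))"
proof -
  define V where "V = X - {u, v}"
  define hu where "hu = (\<lambda>j. hits t {u} (\<lambda>_. {1..s} - {j}) (X - {u}))"
  \<comment> \<open>At \<open>v\<close> any excluded colour serves; 1 is a legal one because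
    \<open>s \<ge> 1\<close>.\<close>
  define hv where "hv = hits t {v} (\<lambda>_. {1..s} - {1}) (X - {v})"
  have finh: "finite (hu j)" "finite hv" for j
    using finite_X by (auto simp: hu_def hv_def hits_def)
  have "2 * M \<le> card (hv - {u})"
  proof -
    have "2 * M + 1 \<le> card hv" using good(2) \<open>s \<ge> 1\<close> by (simp add: good_degree_def hv_def)
    then show ?thesis using diff_card_le_card_Diff[of "{u}" hv] by simp
  qed
  then obtain Sv where Sv: "Sv \<subseteq> hv - {u}" "card Sv = M"
    using obtain_subset_with_card_n[of M "hv - {u}"] by auto
  have SvV: "Sv \<subseteq> V" using Sv(1) by (auto simp: V_def hv_def hits_def)
  then have finSv: "finite Sv" using finite_X finite_subset unfolding V_def by blast
  have "\<exists>i\<in>{1..s}. t ({v, y}, i)" if "y \<in> Sv" for y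
    using that Sv(1) by (auto simp: hv_def hits_def)
  then obtain jc where jc: "\<And>y. y \<in> Sv \<Longrightarrow> jc y \<in> {1..s} \<and> t ({v, y}, jc y)" by metis
  \<comment> \<open>The reason for \<open>2 * M + 1\<close> in \<open>good_degree\<close>:
    discarding \<open>v\<close> and the \<open>M\<close> vertices of \<open>Sv\<close> leaves
    \<open>M\<close>.\<close>
  have "\<exists>S. S \<subseteq> hu j - ({v} \<union> Sv) \<and> card S = M" if "j \<in> {1..s}" for j
  proof -
    have "2 * M + 1 \<le> card (hu j)" using good(1) that by (simp add: good_degree_def hu_def)
    also have "\<dots> \<le> card (hu j - ({v} \<union> Sv)) + card ({v} \<union> Sv)"
      using diff_card_le_card_Diff[of "{v} \<union> Sv" "hu j"] finSv by simp
    also have "card ({v} \<union> Sv) \<le> 1 + M" using card_Un_le[of "{v}" Sv] Sv(2) by simp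
    finally show ?thesis
      using obtain_subset_with_card_n[of M "hu j - ({v} \<union> Sv)"] by auto
  qed
  then obtain S where S: "\<And>j. j \<in> {1..s} \<Longrightarrow> S j \<subseteq> hu j - ({v} \<union> Sv) \<and> card (S j) = M" by metis
  have "\<exists>i\<in>{1..s} - {j}. t ({u, w}, i)" if "j \<in> {1..s}" "w \<in> S j" for j w
    using that S[OF that(1)] by (auto simp: hu_def hits_def)
  then obtain ic where ic: "\<And>j w. j \<in> {1..s} \<Longrightarrow> w \<in> S j \<Longrightarrow> ic j w \<in> {1..s} - {j} \<and> t ({u, w}, ic j w)"
    by metis
  define W where "W = V - Sv"
  \<comment> \<open>\<open>j\<close> is reserved for the last edge and \<open>ic j w\<close> is
    spent on the first.\<close>
  define C where "C = (\<lambda>j w. {1..s} - {j, ic j w})"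
  have WX: "W \<subseteq> X" by (auto simp: W_def V_def)
  have SW: "S j \<subseteq> W" if "j \<in> {1..s}" for j
    using S[OF that] by (auto simp: W_def V_def hu_def hits_def)
  have cardW: "M + m 0 \<le> card W"
  proof -
    have "card V = card X - 2" using uv finite_X unfolding V_def by (simp add: card_Diff_subset)
    moreover have "card W = card V - M"
      unfolding W_def using SvV finSv Sv(2) by (simp add: card_Diff_subset)
    ultimately show ?thesis using assms(12) by simp
  qed
  define few where "few = (\<lambda>\<omega> j. card (reached \<omega> W (S j) (C j) J) < N J)"
  have P_few: "Pr (\<lambda>\<omega>. few \<omega> j) \<le> real J * \<epsilon>" if j: "j \<in> {1..s}" for j
    unfolding few_def
  proof (rule growth[where \<theta> = \<theta> and m = m and r = "s - 2"])
    fix x assume x: "x \<in> S j"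
    have "card (C j x) = s - 2"
      unfolding C_def using ic[OF j x] j by (subst card_Diff_subset) auto
    then show "C j x \<subseteq> {1..s} \<and> s - 2 \<le> card (C j x)" by (auto simp: C_def)
  qed (use assms S[OF j] SW[OF j] WX cardW in auto)
  have "card (jc ` Sv) \<le> M" using card_image_le[OF finSv, of jc] Sv(2) by simp
  \<comment> \<open>Only the reserved colours count, at most \<open>M\<close> of them, so the union
    bound costs no factor \<open>s\<close>.\<close>
  have "Pr (\<lambda>\<omega>. \<exists>j\<in>jc ` Sv. few \<omega> j) \<le> real (card (jc ` Sv)) * (real J * \<epsilon>)"
    using finSv jc P_few by (intro Pr_Bex) auto
  also have "\<dots> \<le> real M * (real J * \<epsilon>)"
    using \<open>card (jc ` Sv) \<le> M\<close> \<open>\<epsilon> \<ge> 0\<close> by (intro mult_right_mono) auto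
  finally have P1: "Pr (\<lambda>\<omega>. \<exists>j\<in>jc ` Sv. few \<omega> j) \<le> real M * (real J * \<epsilon>)" .

  \<comment> \<open>\<open>f\<close> keeps the edges inside \<open>W\<close>. \<open>D\<close>
    collects the colours in which some path ending at \<open>x\<close> can continue to
    \<open>y\<close>, and \<open>K\<close> the coins of the second exposure, any one of which
    completes a connection.\<close>
  define f where "f = (\<lambda>(\<omega> :: 'a set \<times> nat \<Rightarrow> bool) k. fst k \<subseteq> W \<and> \<omega> k)"
  define D where "D = (\<lambda>\<omega> y x. {i. \<exists>vs cs. cpath_from \<omega> W (S (jc y)) (C (jc y)) J vs cs \<and> last vs = x \<and>
      i \<in> C (jc y) (hd vs) - set cs})"
  define K where "K = (\<lambda>\<omega>. (\<lambda>(y, x, i). ({x, y}, i)) `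
      (SIGMA y:Sv. SIGMA x:reached \<omega> W (S (jc y)) (C (jc y)) J. D \<omega> y x))"
  define H where "H = (\<lambda>\<omega>. \<forall>j\<in>jc ` Sv. \<not> few \<omega> j)"
  have f_cong: "f \<omega> (e, i) = \<omega> (e, i)" if "e \<subseteq> W" for \<omega> e i
    using that by (simp add: f_def)
  have fin_reached: "finite (reached \<omega> W T' C' J)" for \<omega> T' C'
    by (rule finite_subset[OF reached_subset finite_subset[OF WX finite_X]])
  have D_sub: "D \<omega> y x \<subseteq> {1..s}" for \<omega> y x
    by (auto simp: D_def C_def)
  then have finD: "finite (D \<omega> y x)" for \<omega> y x by (rule finite_subset) simp
  have cardK: "M * N J * (s - 2 - J) \<le> card (K \<omega>)" if "H \<omega>" for \<omega>
  proof -
    have cardD: "s - 2 - J \<le> card (D \<omega> y x)" if y: "y \<in> Sv" and x: "x \<in> reached \<omega> W (S (jc y)) (C (jc y)) J" for y x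
    proof -
      from x obtain vs cs where path: "cpath_from \<omega> W (S (jc y)) (C (jc y)) J vs cs" "last vs = x"
        unfolding reached_def by blast
      then have w: "hd vs \<in> S (jc y)" and cs: "set cs \<subseteq> C (jc y) (hd vs)" "card (set cs) = J"
        by (auto simp: cpath_from_def distinct_card)
      have "card (C (jc y) (hd vs)) = s - 2"
        unfolding C_def using ic[OF _ w] jc[OF y] by (subst card_Diff_subset) auto
      then have "s - 2 - J = card (C (jc y) (hd vs) - set cs)"
        using cs by (simp add: card_Diff_subset)
      also have "\<dots> \<le> card (D \<omega> y x)"
        using path finD by (intro card_mono) (auto simp: D_def)
      finally show ?thesis .
    qed
    \<comment> \<open>\<open>y\<close> lies in \<open>Sv\<close> and \<open>x\<close> does not, so
      the unordered pair determines both.\<close>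
    have "inj_on (\<lambda>(y, x, i). ({x, y}, i))
        (SIGMA y:Sv. SIGMA x:reached \<omega> W (S (jc y)) (C (jc y)) J. D \<omega> y x)"
      (is "inj_on ?h ?S")
    proof (rule inj_onI)
      fix a b assume ab: "a \<in> ?S" "b \<in> ?S" "?h a = ?h b"
      from ab(1) obtain y x i where a: "a = (y, x, i)" "y \<in> Sv" "x \<in> reached \<omega> W (S (jc y)) (C (jc y)) J"
        by blast
      from ab(2) obtain y' x' i' where b: "b = (y', x', i')" "y' \<in> Sv" "x' \<in> reached \<omega> W (S (jc y')) (C (jc y')) J"
        by blast
      have "x \<notin> Sv" "x' \<notin> Sv"
        using a(3) b(3) reached_subset[of \<omega> W] unfolding W_def by blast+
      with ab(3) a b show "a = b" by (auto simp: doubleton_eq_iff)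
    qed
    then have "card (K \<omega>) = (\<Sum>y\<in>Sv. \<Sum>x\<in>reached \<omega> W (S (jc y)) (C (jc y)) J. card (D \<omega> y x))"
      unfolding K_def using finSv fin_reached finD by (simp add: card_image card_SigmaI)
    moreover have "M * (N J * (s - 2 - J)) \<le> (\<Sum>y\<in>Sv. \<Sum>x\<in>reached \<omega> W (S (jc y)) (C (jc y)) J. card (D \<omega> y x))"
    proof -
      have "N J * (s - 2 - J) \<le> (\<Sum>x\<in>reached \<omega> W (S (jc y)) (C (jc y)) J. card (D \<omega> y x))" if y: "y \<in> Sv" for y
      proof -
        have "N J \<le> card (reached \<omega> W (S (jc y)) (C (jc y)) J)"
          using \<open>H \<omega>\<close> y by (simp add: H_def few_def not_less)
        then have "N J * (s - 2 - J) \<le> (\<Sum>x\<in>reached \<omega> W (S (jc y)) (C (jc y)) J. s - 2 - J)"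
          by simp
        also have "\<dots> \<le> (\<Sum>x\<in>reached \<omega> W (S (jc y)) (C (jc y)) J. card (D \<omega> y x))"
          by (intro sum_mono cardD y)
        finally show ?thesis .
      qed
      then show ?thesis using sum_mono[of Sv "\<lambda>_. N J * (s - 2 - J)"] Sv(2) by simp
    qed
    ultimately show ?thesis by (simp add: mult.assoc)
  qed
  have K_sub: "K \<omega> \<subseteq> colored_edges X s" for \<omega>
  proof
    fix k assume "k \<in> K \<omega>"
    then obtain y x i where k: "k = ({x, y}, i)" "y \<in> Sv" "x \<in> reached \<omega> W (S (jc y)) (C (jc y)) J" "i \<in> D \<omega> y x"
      by (auto simp: K_def)
    then have "x \<in> W" "i \<in> {1..s}" using reached_subset[of \<omega> W] D_sub by blast+
    moreover from this k(2) SvV have "x \<noteq> y" "x \<in> X" "y \<in> X" by (auto simp: W_def V_def)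
    ultimately show "k \<in> colored_edges X s"
      by (simp add: k(1) colored_edges_def all_edges_def)
  qed
  have "depends_on {(e, i). e \<subseteq> W} f"
    by (rule depends_onI) (auto simp: f_def fun_eq_iff)
  moreover have "depends_on {(e, i). e \<inter> Sv \<noteq> {}} (\<lambda>\<omega>. \<forall>k\<in>K t'. \<not> \<omega> k)" for t'
  proof (rule depends_onI)
    fix \<omega> \<omega>' :: "'a set \<times> nat \<Rightarrow> bool"
    assume eq: "\<And>k. k \<in> {(e, i). e \<inter> Sv \<noteq> {}} \<Longrightarrow> \<omega> k = \<omega>' k"
    have "K t' \<subseteq> {(e, i). e \<inter> Sv \<noteq> {}}" unfolding K_def by auto
    then have "\<forall>k\<in>K t'. \<omega> k = \<omega>' k" using eq by blast
    then show "(\<forall>k\<in>K t'. \<not> \<omega> k) = (\<forall>k\<in>K t'. \<not> \<omega>' k)" by blast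
  qed
  moreover have "{(e, i :: nat). e \<subseteq> W} \<inter> {(e, i). e \<inter> Sv \<noteq> {}} = {}" by (auto simp: W_def)
  moreover have "Pr (\<lambda>\<omega>. \<forall>k\<in>K t'. \<not> \<omega> k) \<le> (1 - p) ^ (M * N J * (s - 2 - J))" if "H t'" for t'
    unfolding Pr_no_edge[OF K_sub] using p_nonneg p_le_1 cardK[OF that] by (intro power_decreasing) auto
  ultimately have P2: "Pr (\<lambda>\<omega>. H (f \<omega>) \<and> (\<forall>k\<in>K (f \<omega>). \<not> \<omega> k)) \<le> (1 - p) ^ (M * N J * (s - 2 - J))"
    by (rule Pr_fresh_bound) (use p_le_1 in auto)

  have "Pr (\<lambda>\<omega>. \<not> linked u v t \<omega>)
      \<le> Pr (\<lambda>\<omega>. (\<exists>j\<in>jc ` Sv. few \<omega> j) \<or> (H (f \<omega>) \<and> (\<forall>k\<in>K (f \<omega>). \<not> \<omega> k)))"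
  proof (rule Pr_mono, rule ccontr)
    fix \<omega> assume not_linked: "\<not> linked u v t \<omega>"
    assume *: "\<not> ((\<exists>j\<in>jc ` Sv. few \<omega> j) \<or> (H (f \<omega>) \<and> (\<forall>k\<in>K (f \<omega>). \<not> \<omega> k)))"
    have "few (f \<omega>) j = few \<omega> j" for j
      unfolding few_def using reached_cong[of W "f \<omega>" \<omega>] f_cong by simp
    with * obtain k where k: "k \<in> K (f \<omega>)" "\<omega> k" unfolding H_def by blast
    then obtain y x i where yx: "k = ({x, y}, i)" "y \<in> Sv" "i \<in> D (f \<omega>) y x"
      by (auto simp: K_def)
    then obtain vs cs where "cpath_from (f \<omega>) W (S (jc y)) (C (jc y)) J vs cs" and x: "last vs = x"
      and i: "i \<in> C (jc y) (hd vs) - set cs" unfolding D_def by blast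
    then have "cpath_from \<omega> W (S (jc y)) (C (jc y)) J vs cs"
      using cpath_from_cong[of W "f \<omega>" \<omega>] f_cong by simp
    then have path: "cpath \<omega> vs cs" "hd vs \<in> S (jc y)" "distinct vs" "set vs \<subseteq> W" "distinct cs"
      "set cs \<subseteq> C (jc y) (hd vs)"
      by (auto simp: cpath_from_def)
    have ne: "vs \<noteq> []" using path(1) by (rule cpath_not_Nil)
    have jy: "jc y \<in> {1..s}" "t ({v, y}, jc y)" using jc[OF yx(2)] by auto
    note iw = ic[OF jy(1) path(2)]
    \<comment> \<open>Along the whole path from \<open>u\<close> to \<open>v\<close> the colours
      will be \<open>ic (jc y) (hd vs)\<close>, then \<open>cs\<close>, then \<open>i\<close>, then
      \<open>jc y\<close>.\<close>
    have "cpath \<omega> (vs @ [y]) (cs @ [i])"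
      using path(1) k(2) yx(1) x by (intro cpath_snoc) auto
    moreover have "t ({u, hd (vs @ [y])}, ic (jc y) (hd vs))" "t ({last (vs @ [y]), v}, jc y)"
      using iw jy ne by (auto simp: insert_commute)
    moreover have "distinct (ic (jc y) (hd vs) # jc y # cs @ [i])"
      "set (ic (jc y) (hd vs) # jc y # cs @ [i]) \<subseteq> {1..s}"
      using iw jy(1) i path(5,6) by (auto simp: C_def)
    moreover have "distinct (vs @ [y])" "set (vs @ [y]) \<subseteq> X - {u, v}"
      using path(3,4) yx(2) SvV by (auto simp: W_def V_def)
    ultimately have "linked u v t \<omega>" unfolding linked_def by blast
    with not_linked show False by blast
  qed
  also have "\<dots> \<le> real M * (real J * \<epsilon>) + (1 - p) ^ (M * N J * (s - 2 - J))"
    using Pr_disj[of "\<lambda>\<omega>. \<exists>j\<in>jc ` Sv. few \<omega> j" "\<lambda>\<omega>. H (f \<omega>) \<and> (\<forall>k\<in>K (f \<omega>). \<not> \<omega> k)"] P1 P2 by linarith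
  finally show ?thesis .
qed

text \<open>The degrees of \<open>u\<close> and \<open>v\<close> are decided by the edges meeting
  them, and \<open>linked u v t\<close> for fixed \<open>t\<close> by the edges avoiding them, so
  the bound for fixed \<open>t\<close> carries over to the random one.\<close>

lemma pair_failure:
  assumes uv: "u \<in> X" "v \<in> X" "u \<noteq> v" and "s \<ge> 1" "\<epsilon> \<ge> 0"
    and steps: "\<And>k. k < J \<Longrightarrow> 0 \<le> \<theta> k"
      "\<And>k. k < J \<Longrightarrow> exp (\<theta> k * real (N (Suc k)) - real (m k) * (1 - exp (- (p * real (N k * (s - 2 - k)))))
           * (1 - exp (- \<theta> k))) \<le> \<epsilon>"
      "\<And>k. k < J \<Longrightarrow> N (Suc k) + m (Suc k) \<le> m k"
    and "N 0 = M" "2 * M + m 0 + 2 \<le> card X"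
  shows "Pr (\<lambda>\<omega>. (good_degree M u \<omega> \<and> good_degree M v \<omega>) \<and>
      \<not> (\<exists>vs. path_between X u v vs \<and> rainbow_path s (\<lambda>i. {e \<in> all_edges X. \<omega> (e, i)}) vs))
    \<le> real M * (real J * \<epsilon>) + (1 - p) ^ (M * N J * (s - 2 - J))"
proof -
  define f where "f = (\<lambda>(\<omega> :: 'a set \<times> nat \<Rightarrow> bool) k. fst k \<inter> {u, v} \<noteq> {} \<and> \<omega> k)"
  define H where "H = (\<lambda>t. good_degree M u t \<and> good_degree M v t)"
  have hits_f: "hits (f \<omega>) {w} C (X - {w}) = hits \<omega> {w} C (X - {w})" if "w \<in> {u, v}" for \<omega> w C
    using that by (auto simp: hits_def f_def)
  have H_f: "H (f \<omega>) \<longleftrightarrow> good_degree M u \<omega> \<and> good_degree M v \<omega>" for \<omega>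
    unfolding H_def good_degree_def by (simp add: hits_f)
  have "depends_on {(e, i). e \<inter> {u, v} \<noteq> {}} f"
    by (rule depends_onI) (auto simp: f_def fun_eq_iff)
  moreover have "depends_on {(e, i). e \<subseteq> X - {u, v}} (\<lambda>\<omega>. \<not> linked u v t \<omega>)" for t
  proof (rule depends_onI)
    fix \<omega> \<omega>' :: "'a set \<times> nat \<Rightarrow> bool"
    assume "\<And>k. k \<in> {(e, i). e \<subseteq> X - {u, v}} \<Longrightarrow> \<omega> k = \<omega>' k"
    then have "cpath \<omega> vs cs = cpath \<omega>' vs cs" if "set vs \<subseteq> X - {u, v}" for vs cs
      using cpath_cong[of "X - {u, v}" \<omega> \<omega>' vs cs] that by simp
    then show "(\<not> linked u v t \<omega>) = (\<not> linked u v t \<omega>')"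
      unfolding linked_def by metis
  qed
  moreover have "{(e, i :: nat). e \<inter> {u, v} \<noteq> {}} \<inter> {(e, i). e \<subseteq> X - {u, v}} = {}"
    by auto
  moreover have "Pr (\<lambda>\<omega>. \<not> linked u v t \<omega>) \<le> real M * (real J * \<epsilon>) + (1 - p) ^ (M * N J * (s - 2 - J))"
    if "H t" for t
    using that assms unfolding H_def by (intro linked_failure[where \<theta> = \<theta> and m = m]) auto
  ultimately have *: "Pr (\<lambda>\<omega>. H (f \<omega>) \<and> \<not> linked u v (f \<omega>) \<omega>)
      \<le> real M * (real J * \<epsilon>) + (1 - p) ^ (M * N J * (s - 2 - J))"
    by (rule Pr_fresh_bound) (use p_le_1 \<open>\<epsilon> \<ge> 0\<close> in auto)
  have "\<exists>vs. path_between X u v vs \<and> rainbow_path s (\<lambda>i. {e \<in> all_edges X. \<omega> (e, i)}) vs"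
    if linked: "linked u v (f \<omega>) \<omega>" for \<omega>
  proof -
    from linked obtain i vs cs j where path: "f \<omega> ({u, hd vs}, i)" "f \<omega> ({last vs, v}, j)" "cpath \<omega> vs cs"
      "distinct (i # j # cs)" "distinct vs" "set vs \<subseteq> X - {u, v}" "set (i # j # cs) \<subseteq> {1..s}"
      unfolding linked_def by blast
    have ne: "vs \<noteq> []" using path(3) by (rule cpath_not_Nil)
    have "cpath \<omega> (vs @ [v]) (cs @ [j])"
      using path(2,3) by (intro cpath_snoc) (auto simp: f_def)
    then have "cpath \<omega> (u # vs @ [v]) (i # cs @ [j])"
      using path(1) ne by (intro cpath_Cons) (auto simp: f_def)
    then have "rainbow_path s (\<lambda>i. {e \<in> all_edges X. \<omega> (e, i)}) (u # vs @ [v])"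
      using path uv by (intro rainbow_path_if_cpath) auto
    moreover have "path_between X u v (u # vs @ [v])"
      using path uv by (auto simp: path_between_def)
    ultimately show ?thesis by blast
  qed
  then have "Pr (\<lambda>\<omega>. (good_degree M u \<omega> \<and> good_degree M v \<omega>) \<and>
      \<not> (\<exists>vs. path_between X u v vs \<and> rainbow_path s (\<lambda>i. {e \<in> all_edges X. \<omega> (e, i)}) vs))
    \<le> Pr (\<lambda>\<omega>. H (f \<omega>) \<and> \<not> linked u v (f \<omega>) \<omega>)"
    unfolding H_f by (intro Pr_mono) blast
  with * show ?thesis by linarith
qed

text \<open>A union bound over the excluded colour would cost a factor \<open>s\<close>, which is unbounded in terms of \<open>n\<close>; instead
  a whole residue class of colours modulo the constant \<open>b\<close> is excluded.\<close>

lemma good_degree_failure: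
  assumes "u \<in> X" "b > 0" "\<theta> \<ge> 0"
  shows "Pr (\<lambda>\<omega>. \<not> good_degree M u \<omega>) \<le> real b * exp (\<theta> * real (2 * M + 1)
    - real (card X - 1) * (1 - exp (- (p * real (s - s div b - 1)))) * (1 - exp (- \<theta>)))"
proof -
  define C where "C = (\<lambda>\<rho>. {i \<in> {1..s}. i mod b \<noteq> \<rho>})"
  have cardC: "s - s div b - 1 \<le> card (C \<rho>)" for \<rho>
  proof -
    \<comment> \<open>Within a residue class the quotient by \<open>b\<close> is injective, so the
      class has at most \<open>s div b + 1\<close> members.\<close>
    have "inj_on (\<lambda>i. i div b) {i \<in> {1..s}. i mod b = \<rho>}"
    proof (rule inj_onI)
      fix x y assume "x \<in> {i \<in> {1..s}. i mod b = \<rho>}" "y \<in> {i \<in> {1..s}. i mod b = \<rho>}" "x div b = y div b"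
      then show "x = y" using div_mult_mod_eq[of x b] div_mult_mod_eq[of y b] by simp
    qed
    then have "card {i \<in> {1..s}. i mod b = \<rho>} \<le> card {0..s div b}"
      by (rule card_inj_on_le) (auto intro: div_le_mono)
    moreover have "C \<rho> = {1..s} - {i \<in> {1..s}. i mod b = \<rho>}" by (auto simp: C_def)
    moreover have "card {1..s} - card {i \<in> {1..s}. i mod b = \<rho>} \<le> card ({1..s} - {i \<in> {1..s}. i mod b = \<rho>})"
      by (rule diff_card_le_card_Diff) simp
    ultimately show ?thesis by simp
  qed
  let ?few = "\<lambda>\<rho> \<omega>. card (hits \<omega> {u} (\<lambda>_. C \<rho>) (X - {u})) < 2 * M + 1"
  have "Pr (\<lambda>\<omega>. \<not> good_degree M u \<omega>) \<le> Pr (\<lambda>\<omega>. \<exists>\<rho>\<in>{..<b}. ?few \<rho> \<omega>)"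
  proof (rule Pr_mono)
    fix \<omega> assume "\<not> good_degree M u \<omega>"
    then obtain j where j: "card (hits \<omega> {u} (\<lambda>_. {1..s} - {j}) (X - {u})) < 2 * M + 1"
      unfolding good_degree_def by (metis not_less)
    have "card (hits \<omega> {u} (\<lambda>_. C (j mod b)) (X - {u})) \<le> card (hits \<omega> {u} (\<lambda>_. {1..s} - {j}) (X - {u}))"
      using finite_X by (intro card_mono) (auto simp: hits_def C_def)
    with j have "?few (j mod b) \<omega>" by simp
    then show "\<exists>\<rho>\<in>{..<b}. ?few \<rho> \<omega>" using \<open>b > 0\<close> by force
  qed
  also have "\<dots> \<le> real (card {..<b}) * exp (\<theta> * real (2 * M + 1)
    - real (card X - 1) * (1 - exp (- (p * real (s - s div b - 1)))) * (1 - exp (- \<theta>)))"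
    using assms cardC finite_X by (intro Pr_Bex hits_tail_exp) (auto simp: C_def)
  finally show ?thesis by simp
qed

lemma rainbow_connected_failure:
  assumes "s \<ge> 1" "\<epsilon> \<ge> 0"
    and degree: "\<And>u. u \<in> X \<Longrightarrow> Pr (\<lambda>\<omega>. \<not> good_degree M u \<omega>) \<le> \<eta>"
    and steps: "\<And>k. k < J \<Longrightarrow> 0 \<le> \<theta> k"
      "\<And>k. k < J \<Longrightarrow> exp (\<theta> k * real (N (Suc k)) - real (m k) * (1 - exp (- (p * real (N k * (s - 2 - k)))))
           * (1 - exp (- \<theta> k))) \<le> \<epsilon>"
      "\<And>k. k < J \<Longrightarrow> N (Suc k) + m (Suc k) \<le> m k"
    and "N 0 = M" "2 * M + m 0 + 2 \<le> card X"
  shows "Pr (\<lambda>\<omega>. \<not> rainbow_connected X s (\<lambda>i. {e \<in> all_edges X. \<omega> (e, i)})) \<le>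
    real (card X) * \<eta> + (real (card X))\<^sup>2 * (real M * (real J * \<epsilon>) + (1 - p) ^ (M * N J * (s - 2 - J)))"
proof -
  let ?B = "\<lambda>u v \<omega>. (good_degree M u \<omega> \<and> good_degree M v \<omega>) \<and>
      \<not> (\<exists>vs. path_between X u v vs \<and> rainbow_path s (\<lambda>i. {e \<in> all_edges X. \<omega> (e, i)}) vs)"
  let ?z = "real M * (real J * \<epsilon>) + (1 - p) ^ (M * N J * (s - 2 - J))"
  let ?D = "{(u, v). u \<in> X \<and> v \<in> X \<and> u \<noteq> v}"
  have D: "?D \<subseteq> X \<times> X" by auto
  then have finD: "finite ?D" using finite_X finite_subset finite_cartesian_product by blast
  have "card ?D \<le> card X * card X"
    using card_mono[OF _ D] finite_X by (simp add: card_cartesian_product)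
  then have cardD: "real (card ?D) \<le> (real (card X))\<^sup>2"
    unfolding power2_eq_square of_nat_mult[symmetric] by (simp only: of_nat_le_iff)
  have z: "?z \<ge> 0" using p_le_1 \<open>\<epsilon> \<ge> 0\<close> by simp
  have "Pr (\<lambda>\<omega>. \<not> rainbow_connected X s (\<lambda>i. {e \<in> all_edges X. \<omega> (e, i)}))
      \<le> Pr (\<lambda>\<omega>. (\<exists>u\<in>X. \<not> good_degree M u \<omega>) \<or> (\<exists>x\<in>?D. ?B (fst x) (snd x) \<omega>))"
  proof (rule Pr_mono)
    fix \<omega> assume "\<not> rainbow_connected X s (\<lambda>i. {e \<in> all_edges X. \<omega> (e, i)})"
    then obtain u v where uv: "u \<in> X" "v \<in> X" "u \<noteq> v"
      "\<not> (\<exists>vs. path_between X u v vs \<and> rainbow_path s (\<lambda>i. {e \<in> all_edges X. \<omega> (e, i)}) vs)"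
      unfolding rainbow_connected_def by blast
    show "(\<exists>u\<in>X. \<not> good_degree M u \<omega>) \<or> (\<exists>x\<in>?D. ?B (fst x) (snd x) \<omega>)"
    proof (cases "\<exists>u\<in>X. \<not> good_degree M u \<omega>")
      case False
      with uv have "(u, v) \<in> ?D" "?B (fst (u, v)) (snd (u, v)) \<omega>" by auto
      then show ?thesis by blast
    qed simp
  qed
  also have "\<dots> \<le> Pr (\<lambda>\<omega>. \<exists>u\<in>X. \<not> good_degree M u \<omega>) + Pr (\<lambda>\<omega>. \<exists>x\<in>?D. ?B (fst x) (snd x) \<omega>)"
    by (rule Pr_disj)
  also have "\<dots> \<le> real (card X) * \<eta> + real (card ?D) * ?z"
    using finD finite_X degree assms
    by (intro add_mono Pr_Bex pair_failure[where \<theta> = \<theta> and m = m]) auto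
  also have "\<dots> \<le> real (card X) * \<eta> + (real (card X))\<^sup>2 * ?z"
    using mult_right_mono[OF cardD z] by simp
  finally show ?thesis .
qed

end

section \<open>The schedule of level sizes\<close>

text \<open>\<open>real l ^ l / fact l\<close> is a single term of the exponential series at
  \<open>l\<close>.\<close>

lemma power_self_le_exp_fact: "real l ^ l \<le> exp (real l) * fact l"
proof -
  have "(\<Sum>k\<in>{l}. inverse (fact k) * real l ^ k) \<le> (\<Sum>k. inverse (fact k) * real l ^ k)"
    by (intro sum_le_suminf summable_exp) auto
  also have "\<dots> = exp (real l)" by (simp add: exp_def scaleR_conv_of_real)
  finally show ?thesis by (simp add: field_simps)
qed

lemma prod_shifted_eq_fact: "(\<Prod>k<q. real (q + 1 - k)) = fact (q + 1)"
proof (induction q)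
  case (Suc q)
  have "(\<Prod>k<Suc q. real (Suc q + 1 - k)) = real (q + 2) * (\<Prod>k<q. real (q + 1 - k))"
    by (subst prod.lessThan_Suc_shift) simp
  with Suc show ?case by (simp add: algebra_simps)
qed simp

text \<open>The share \<open>(s - 2 - k) / s\<close> increases with \<open>s\<close>, so
  \<open>s\<close> may be replaced by \<open>l\<close>. The shares then multiply to
  \<open>fact (l - 2) / l ^ (l - 3)\<close>, which is at least \<open>l * exp (- l)\<close> because
  \<open>fact l \<le> l * l * fact (l - 2)\<close> and
  \<open>l ^ l \<le> exp l * fact l\<close>.\<close>

lemma prod_available_colours:
  fixes l s :: nat and x :: real
  assumes l: "4 \<le> l" "l \<le> s" and x: "x \<ge> 0"
  shows "x ^ (l - 3) * (real l * exp (- real l)) \<le> (\<Prod>k<l - 3. x * (real (s - 2 - k) / real s))"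
proof -
  define q where "q = l - 3"
  have q: "l = q + 3" using l by (simp add: q_def)
  have l0: "real l > 0" using l by simp
  have "real l ^ (q + 1) * (real l * real l) \<le> exp (real l) * (real l * real l * fact (q + 1))"
  proof -
    have "fact l = real l * (real (q + 2) * fact (q + 1))"
      by (simp add: q numeral_3_eq_3 algebra_simps)
    also have "\<dots> \<le> real l * (real l * fact (q + 1))"
      by (intro mult_left_mono mult_right_mono) (auto simp: q)
    finally have "exp (real l) * fact l \<le> exp (real l) * (real l * real l * fact (q + 1))"
      by (simp add: mult.assoc)
    moreover have "real l ^ l = real l ^ (q + 1) * (real l * real l)"
      by (simp add: q numeral_3_eq_3 algebra_simps)
    ultimately show ?thesis using power_self_le_exp_fact[of l] by linarith
  qed
  then have "real l * real l * (real l * real l ^ q) \<le> real l * real l * (exp (real l) * fact (q + 1))"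
    by (simp add: mult_ac)
  then have "real l * real l ^ q \<le> exp (real l) * fact (q + 1)"
    by (rule mult_left_le_imp_le) (use l0 in simp)
  then have *: "real l * exp (- real l) \<le> fact (q + 1) / real l ^ q"
    using l0 by (simp add: exp_minus field_simps)
  have "(\<Prod>k<q. real (q + 1 - k) / real l) \<le> (\<Prod>k<q. real (s - 2 - k) / real s)"
  proof (intro prod_mono conjI)
    fix k assume k: "k \<in> {..<q}"
    have "real (q + 1 - k) / real l = 1 - (real k + 2) / real l"
      using k by (simp add: q field_simps of_nat_diff)
    also have "\<dots> \<le> 1 - (real k + 2) / real s"
      using l l0 by (simp add: frac_le)
    also have "\<dots> = real (s - 2 - k) / real s"
      using k l l0 by (simp add: q field_simps of_nat_diff)
    finally show "real (q + 1 - k) / real l \<le> real (s - 2 - k) / real s" .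
  qed simp
  also have "(\<Prod>k<q. real (q + 1 - k) / real l) = fact (q + 1) / real l ^ q"
    by (simp only: prod_dividef prod_shifted_eq_fact prod_constant card_lessThan)
  finally have "real l * exp (- real l) \<le> (\<Prod>k<q. real (s - 2 - k) / real s)"
    using * by linarith
  then have "x ^ q * (real l * exp (- real l)) \<le> x ^ q * (\<Prod>k<q. real (s - 2 - k) / real s)"
    using x by (intro mult_left_mono) auto
  also have "\<dots> = (\<Prod>k<q. x * (real (s - 2 - k) / real s))"
    by (simp only: prod.distrib prod_constant card_lessThan)
  finally show ?thesis by (simp only: q_def)
qed

text \<open>Multiplying \<open>1 - x + x^2 / 2\<close> by the Taylor bound
  \<open>1 + x + x^2 / 2\<close> for \<open>exp x\<close> gives \<open>1 + x^4 / 4\<close>. The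
  factor \<open>1 - x / 2\<close> will measure the loss from vertices hit more than once.\<close>

lemma one_minus_exp_ge:
  fixes x :: real
  assumes "0 \<le> x"
  shows "x * (1 - x / 2) \<le> 1 - exp (- x)"
proof -
  have "1 \<le> (1 - x + x\<^sup>2 / 2) * (1 + x + x\<^sup>2 / 2)"
    using assms by (simp add: algebra_simps power2_eq_square)
  also have "\<dots> \<le> (1 - x + x\<^sup>2 / 2) * exp x"
  proof (intro mult_left_mono exp_lower_Taylor_quadratic assms)
    have "0 \<le> (1 - x)\<^sup>2" by simp
    then show "0 \<le> 1 - x + x\<^sup>2 / 2" unfolding power2_eq_square left_diff_distrib right_diff_distrib by simp
  qed
  finally have "exp (- x) \<le> 1 - x + x\<^sup>2 / 2" by (simp add: exp_minus field_simps)
  then show ?thesis by (simp add: algebra_simps power2_eq_square)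
qed

lemma one_minus_exp_mono: "x \<le> y \<Longrightarrow> 1 - exp (- x) \<le> 1 - exp (- (y :: real))"
  by simp

text \<open>The ideal size of level \<open>k\<close> is \<open>g k\<close>. The prescribed size \<open>w k * g k\<close> gives away \<open>(1 / 2) ^ k / 8\<close> in step \<open>k\<close>
  for the concentration of the binomial distribution, and \<open>4 * g k / n\<close> in total for visited vertices and
  for vertices that are hit more than once.\<close>

lemma growth_schedule:
  fixes n s l M :: nat and c L p :: real
  assumes l: "4 \<le> l" "l \<le> s" and n: "n > 0" and L: "L \<ge> 0" and c: "c > 0"
    and p: "p = c * L / (real s * real n)"
    and ratio: "7 * real l \<le> 2 * c * L"
    and total: "real n / 16 \<le> real M * ((c * L) ^ (l - 3) * (real l * exp (- real l)))"
    and M: "2 \<le> M" "16 * M < n" "128 * (5 * L + 1) \<le> real M * (c * L / 2)"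
    and n_large: "700 * (5 * L + 1) \<le> real n"
  obtains J N m \<theta> where "J + 3 \<le> l" "N 0 = M" "real n / 128 \<le> real (N J)" "2 * M + m 0 + 2 \<le> n"
    "\<And>k. k < J \<Longrightarrow> 0 \<le> \<theta> k"
    "\<And>k. k < J \<Longrightarrow> exp (\<theta> k * real (N (Suc k)) - real (m k) * (1 - exp (- (p * real (N k * (s - 2 - k)))))
       * (1 - exp (- \<theta> k))) \<le> exp (- (5 * L))"
    "\<And>k. k < J \<Longrightarrow> N (Suc k) + m (Suc k) \<le> m k"
proof -
  \<comment> \<open>The expected growth factor \<open>p * n * (s - 2 - k)\<close> of level
    \<open>k\<close>.\<close>
  define \<mu> where "\<mu> = (\<lambda>k. c * L * (real (s - 2 - k) / real s))"
  define g where "g = (\<lambda>k. real M * (\<Prod>i<k. \<mu> i))"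
  have s0: "real s > 0" and n0: "real n > 0" using l n by auto
  have g0: "g 0 = real M" and gS: "g (Suc k) = g k * \<mu> k" for k
    by (simp_all add: g_def)
  have \<mu>7: "7 \<le> \<mu> k" if "k + 4 \<le> l" for k
  proof -
    have "7 \<le> c * L * (2 / real l)" using ratio l by (simp add: field_simps)
    also have "\<dots> \<le> c * L * (real (s - 2 - k) / real s)"
    proof (intro mult_left_mono)
      have "(real k + 2) / real s \<le> (real k + 2) / real l" using l by (intro divide_left_mono) auto
      moreover have "(real k + 2) / real l + 2 / real l \<le> 1"
        using that l unfolding add_divide_distrib[symmetric] by simp
      moreover have "real (s - 2 - k) / real s = 1 - (real k + 2) / real s"
        using that l by (simp add: field_simps of_nat_diff)
      ultimately show "2 / real l \<le> real (s - 2 - k) / real s" by linarith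
    qed (use L c in auto)
    finally show ?thesis unfolding \<mu>_def .
  qed
  \<comment> \<open>The first level whose ideal size is a constant share of \<open>n\<close>;
    \<open>total\<close> makes it occur by level \<open>l - 3\<close>.\<close>
  define J where "J = (LEAST k. real n / 16 \<le> g k)"
  have g_end: "real n / 16 \<le> g (l - 3)"
  proof -
    have "real M * ((c * L) ^ (l - 3) * (real l * exp (- real l))) \<le> g (l - 3)"
      unfolding g_def \<mu>_def using L c l by (intro mult_left_mono prod_available_colours) auto
    with total show ?thesis by linarith
  qed
  have gJ: "real n / 16 \<le> g J" unfolding J_def using g_end by (rule LeastI)
  have "J \<le> l - 3" unfolding J_def using g_end by (rule Least_le)
  then have Jl: "J + 3 \<le> l" using l by linarith
  have g_less: "g k < real n / 16" if "k < J" for k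
    using not_less_Least[of k "\<lambda>k. real n / 16 \<le> g k"] that by (simp add: J_def not_le)
  have J0: "J > 0"
  proof (rule ccontr)
    assume "\<not> J > 0"
    then have "real n / 16 \<le> real M" using gJ g0 by simp
    moreover have "16 * real M < real n" using M(2) by linarith
    ultimately show False by simp
  qed
  have \<mu>J: "7 \<le> \<mu> k" if "k < J" for k using \<mu>7[of k] that Jl by simp
  have gM: "real M \<le> g k" if "k \<le> J" for k
    using that
  proof (induction k)
    case (Suc k)
    have "g k * 1 \<le> g k * \<mu> k" using Suc \<mu>J[of k] by (intro mult_left_mono) auto
    with Suc show ?case by (simp add: gS)
  qed (simp add: g0)
  have g7: "7 * g k \<le> g (Suc k)" if "k < J" for k
  proof -
    have "g k * 7 \<le> g k * \<mu> k" using gM[of k] \<mu>J[OF that] that M(1) by (intro mult_left_mono) auto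
    then show ?thesis by (simp add: gS)
  qed
  have g2: "2 \<le> g k" if "k \<le> J" for k using gM[OF that] M(1) by linarith
  have g1: "128 * (5 * L + 1) \<le> g 1"
  proof -
    have half: "1 / 2 \<le> real (s - 2 - 0) / real s" using l by (simp add: field_simps of_nat_diff)
    have "c * L * (1 / 2) \<le> \<mu> 0" unfolding \<mu>_def by (rule mult_left_mono[OF half]) (use L c in simp)
    then have "real M * (c * L * (1 / 2)) \<le> real M * \<mu> 0" by (rule mult_left_mono) simp
    then have "real M * (c * L / 2) \<le> g 1" using gS[of 0] g0 by simp
    with M(3) show ?thesis by linarith
  qed
  \<comment> \<open>Growth by 4 per level offsets the squared slack \<open>\<delta>\<^sup>2\<close>
    below, which shrinks by exactly this factor.\<close>
  have g4: "4 ^ k * g 1 \<le> g (Suc k)" if "k < J" for k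
    using that
  proof (induction k)
    case (Suc k)
    have "4 ^ Suc k * g 1 \<le> 7 * g (Suc k)" using Suc g2[of "Suc k"] by simp
    with g7[of "Suc k"] Suc.prems show ?case by linarith
  qed simp

  define w where "w = (\<lambda>k. 3 / 4 + (1 / 2) ^ k / 4 - 4 * (g k / real n))"
  \<comment> \<open>The last level is asked for only \<open>n / 128\<close>: its ideal size may be
    out of reach, since collisions are no longer rare.\<close>
  define N where "N = (\<lambda>k. if k = 0 then M else if k < J then nat \<lceil>w k * g k\<rceil> else nat \<lceil>real n / 128\<rceil>)"
  \<comment> \<open>Besides the levels so far, \<open>u\<close>, \<open>v\<close> and the
    \<open>M\<close> chosen neighbours of \<open>v\<close> are excluded.\<close>
  define m where "m = (\<lambda>k. (n - 2 - M) - (\<Sum>i\<le>k. N i))"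
  \<comment> \<open>The Chernoff parameter equals the slack of the step; in the last step the slack
    is a constant factor, so 1 suffices.\<close>
  define \<theta> where "\<theta> = (\<lambda>k. if Suc k < J then (1 / 2) ^ k / 8 else 1 :: real)"
  have gn: "0 \<le> g k / real n" "g k / real n \<le> 1 / 16" if "k < J" for k
    using g_less[OF that] g2[of k] that n0 by (auto simp: field_simps)
  have w: "1 / 2 \<le> w k" "w k \<le> 1" if "k < J" for k
  proof -
    have "(1 / 2 :: real) ^ k \<le> 1" "0 \<le> (1 / 2 :: real) ^ k" by (auto simp: power_le_one)
    with gn[OF that] show "1 / 2 \<le> w k" "w k \<le> 1" unfolding w_def by linarith+
  qed
  have N: "w k * g k \<le> real (N k)" "real (N k) \<le> w k * g k + 1 \<or> k = 0" if "k < J" for k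
  proof -
    have wg: "0 \<le> w k * g k" using w[OF that] g2[of k] that by (intro mult_nonneg_nonneg) auto
    show "w k * g k \<le> real (N k)"
    proof (cases "k = 0")
      case True
      then show ?thesis using w[OF that] by (simp add: N_def g0 mult_left_le_one_le)
    next
      case False
      then show ?thesis using that wg by (simp add: N_def real_nat_ceiling_ge)
    qed
    show "real (N k) \<le> w k * g k + 1 \<or> k = 0"
      using that wg by (simp add: N_def)
  qed
  have Ng: "real (N k) \<le> g k + 1" if "k < J" for k
  proof (cases "k = 0")
    case True
    then show ?thesis by (simp add: N_def g0)
  next
    case False
    have "w k * g k \<le> g k" using w[OF that] g2[of k] that by (simp add: mult_left_le_one_le)
    with False N(2)[OF that] show ?thesis by linarith
  qed
  have sumN: "real (\<Sum>i\<le>k. N i) \<le> 3 * g k" if "k < J" for k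
    using that
  proof (induction k)
    case 0
    then show ?case by (simp add: N_def g0)
  next
    case (Suc k)
    then show ?case using Ng[of "Suc k"] g7[of k] g2[of "Suc k"] by simp
  qed
  have m_ge: "real n - 6 * g k \<le> real (m k)" if "k < J" for k
    using sumN[OF that] gM[of k] that M(1) unfolding m_def by linarith
  have NJ: "real n / 128 \<le> real (N J)" "real (N J) \<le> real n / 128 + 1"
    using J0 by (simp_all add: N_def real_nat_ceiling_ge)
  have n700: "700 \<le> real n" using n_large L by (simp add: algebra_simps)
  show ?thesis
  proof (rule that[of J N m \<theta>])
    show "J + 3 \<le> l" "real n / 128 \<le> real (N J)" by fact+
    show "N 0 = M" by (simp add: N_def)
    then show "2 * M + m 0 + 2 \<le> n" using M by (simp add: m_def)
    show "0 \<le> \<theta> k" for k by (simp add: \<theta>_def)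
    show "N (Suc k) + m (Suc k) \<le> m k" if k: "k < J" for k
    proof -
      have "real (N (Suc k)) \<le> real n / 16 + 1"
        using Ng[of "Suc k"] g_less[of "Suc k"] NJ(2) k by (cases "Suc k = J") auto
      then have "real (N (Suc k)) \<le> real (m k)"
        using m_ge[OF k] g_less[OF k] n700 by linarith
      then show ?thesis by (simp add: m_def)
    qed
    show "exp (\<theta> k * real (N (Suc k)) - real (m k) * (1 - exp (- (p * real (N k * (s - 2 - k)))))
       * (1 - exp (- \<theta> k))) \<le> exp (- (5 * L))" if k: "k < J" for k
    proof -
      define z where "z = w k * g (Suc k)"
      define e where "e = p * real (N k * (s - 2 - k))"
      have "e = real (N k) * \<mu> k / real n"
        unfolding e_def p \<mu>_def by (simp add: field_simps)
      moreover have "z \<le> real (N k) * \<mu> k"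
        unfolding z_def gS using mult_right_mono[OF N(1)[OF k], of "\<mu> k"] \<mu>J[OF k] by (simp add: mult.assoc)
      ultimately have ze: "z / real n \<le> e" using n0 by (simp add: divide_right_mono)
      have m0: "0 \<le> real n - 6 * g k" using g_less[OF k] by linarith
      have "\<theta> k * real (N (Suc k)) - real (m k) * (1 - exp (- e)) * (1 - exp (- \<theta> k)) \<le> - (5 * L)"
      proof (cases "Suc k < J")
        case True
        define \<delta> :: real where "\<delta> = (1 / 2) ^ k / 8"
        define G where "G = g (Suc k) / real n"
        have \<delta>: "\<theta> k = \<delta>" "0 \<le> \<delta>" "\<delta> \<le> 1 / 8"
          using True by (auto simp: \<theta>_def \<delta>_def power_le_one)
        have G: "0 \<le> G" "G \<le> 1 / 16" using gn[OF True] by (auto simp: G_def)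
        have gpos: "0 \<le> g (Suc k)" using g2[of "Suc k"] k by linarith
        have z: "0 \<le> z" "z \<le> g (Suc k)"
          using w[OF k] gpos unfolding z_def by (auto simp: mult_left_le_one_le)
        have gG: "g k / real n \<le> G / 7" unfolding G_def using g7[OF k] n0 by (simp add: field_simps)
        have zn: "z / real n \<le> G" unfolding G_def using z n0 by (simp add: divide_right_mono)
        \<comment> \<open>Visited vertices cost a share \<open>6 * g k / n \<le> 6 * G / 7\<close>
          and multiple hits a share \<open>G / 2\<close>, together at most
          \<open>2 * G\<close>.\<close>
        have zm: "z * (1 - 2 * G) \<le> real (m k) * (1 - exp (- e))"
        proof -
          have "z * (1 - 2 * G) \<le> z * ((1 - 6 * (G / 7)) * (1 - G / 2))"
            using z(1) G by (intro mult_left_mono) (auto simp: algebra_simps)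
          also have "\<dots> \<le> z * ((1 - 6 * (g k / real n)) * (1 - z / real n / 2))"
            using z G gG zn by (intro mult_left_mono mult_mono) auto
          also have "\<dots> = (real n - 6 * g k) * (z / real n * (1 - z / real n / 2))"
            using n0 by (simp add: field_simps)
          also have "\<dots> \<le> (real n - 6 * g k) * (1 - exp (- (z / real n)))"
            using m0 z n0 by (intro mult_left_mono one_minus_exp_ge) auto
          also have "\<dots> \<le> real (m k) * (1 - exp (- e))"
            using m_ge[OF k] m0 z n0 ze by (intro mult_mono one_minus_exp_mono) auto
          finally show ?thesis .
        qed
        have "0 \<le> z * (1 - 2 * G)" using z G by simp
        with zm have "z * (1 - 2 * G) * (\<delta> * (1 - \<delta> / 2)) \<le> real (m k) * (1 - exp (- e)) * (1 - exp (- \<delta>))"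
          using \<delta> by (intro mult_mono[OF zm one_minus_exp_ge]) auto
        \<comment> \<open>The expectation loses \<open>2 * G + \<delta> / 2\<close>, while the
          target gave away \<open>\<delta> + 3 * G\<close>. The difference makes the exponent at
          most \<open>\<delta> - \<delta>\<^sup>2 * g (Suc k) / 2\<close>.\<close>
        moreover have "z - g (Suc k) * (2 * G + \<delta> / 2) \<le> z * (1 - 2 * G) * (1 - \<delta> / 2)"
        proof -
          have "z * (2 * G + \<delta> / 2) \<le> g (Suc k) * (2 * G + \<delta> / 2)"
            using z G \<delta> by (intro mult_right_mono) auto
          moreover have "0 \<le> z * (2 * G) * (\<delta> / 2)" using z G \<delta> by simp
          ultimately show ?thesis by (simp add: algebra_simps)
        qed
        then have "\<delta> * (z - g (Suc k) * (2 * G + \<delta> / 2)) \<le> \<delta> * (z * (1 - 2 * G) * (1 - \<delta> / 2))"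
          using \<delta> by (intro mult_left_mono)
        moreover have "\<delta> * real (N (Suc k)) \<le> \<delta> * (z - (\<delta> + 3 * G) * g (Suc k) + 1)"
        proof (intro mult_left_mono)
          \<comment> \<open>Since \<open>g k / n \<le> G / 7\<close>, the term
            \<open>4 * g / n\<close> rises by at least \<open>24 * G / 7\<close>.\<close>
          have "w (Suc k) \<le> w k - (\<delta> + 3 * G)"
            using gG G unfolding w_def \<delta>_def G_def by simp
          then have "w (Suc k) * g (Suc k) \<le> z - (\<delta> + 3 * G) * g (Suc k)"
            unfolding z_def left_diff_distrib[symmetric] using gpos by (rule mult_right_mono)
          then show "real (N (Suc k)) \<le> z - (\<delta> + 3 * G) * g (Suc k) + 1"
            using N(2)[OF True] by linarith
        qed (use \<delta> in auto)
        moreover have "\<delta> * (z - (\<delta> + 3 * G) * g (Suc k) + 1) - \<delta> * (z - g (Suc k) * (2 * G + \<delta> / 2))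
            \<le> \<delta> - \<delta>\<^sup>2 * g (Suc k) / 2"
        proof -
          have "0 \<le> \<delta> * (G * g (Suc k))" using \<delta> G gpos by simp
          then show ?thesis by (simp add: algebra_simps power2_eq_square)
        qed
        moreover have "5 * L + 1 \<le> \<delta>\<^sup>2 * g (Suc k) / 2"
        proof -
          have "\<delta>\<^sup>2 * 4 ^ k = 1 / 64"
            unfolding \<delta>_def by (simp add: power2_eq_square field_simps power_mult_distrib[symmetric])
          then have "g 1 / 64 = \<delta>\<^sup>2 * (4 ^ k * g 1)" by (simp add: mult.assoc[symmetric])
          also have "\<dots> \<le> \<delta>\<^sup>2 * g (Suc k)" using g4[OF k] by (intro mult_left_mono) auto
          finally show ?thesis using g1 by (simp add: algebra_simps)
        qed
        ultimately show ?thesis using \<delta> by (simp add: mult_ac)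
      next
        case False
        with k have kJ: "Suc k = J" by simp
        have \<theta>1: "\<theta> k = 1" using False by (simp add: \<theta>_def)
        have "1 / 2 * (real n / 16) \<le> w k * g (Suc k)"
          using w[OF k] gJ kJ by (intro mult_mono) auto
        then have "1 / 32 \<le> z / real n" unfolding z_def using n0 by (simp add: field_simps)
        with ze have e: "1 / 32 \<le> e" by linarith
        have "(33 / 32 :: real) \<le> exp (1 / 32)" using exp_ge_add_one_self[of "1 / 32 :: real"] by simp
        then have "1 / 33 \<le> 1 - exp (- (1 / 32 :: real))" by (simp add: exp_minus field_simps)
        also have "\<dots> \<le> 1 - exp (- e)" using e by simp
        finally have a: "1 / 33 \<le> 1 - exp (- e)" .
        have "(2 :: real) \<le> exp 1" using exp_ge_add_one_self[of "1 :: real"] by simp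
        then have b: "1 / 2 \<le> 1 - exp (- (1 :: real))" by (simp add: exp_minus field_simps)
        have "real n * (10 / 16) \<le> real (m k)" using m_ge[OF k] g_less[OF k] by linarith
        \<comment> \<open>This product of constants exceeds \<open>1 / 128\<close> by more than
          \<open>1 / 700\<close>; by \<open>n_large\<close> the surplus pays for
          \<open>5 * L\<close> and for rounding up \<open>N J\<close>.\<close>
        then have "real n * (10 / 16) * (1 / 33) * (1 / 2) \<le> real (m k) * (1 - exp (- e)) * (1 - exp (- (1 :: real)))"
          using a b e by (intro mult_mono mult_nonneg_nonneg) auto
        then show ?thesis using NJ(2) kJ n_large \<theta>1 by simp
      qed
      then show ?thesis by (simp add: e_def)
    qed
  qed
qed

section \<open>Asymptotics\<close>

text \<open>The result for a single \<open>n\<close>, with each asymptotic requirement as an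
  explicit inequality. The error adds the degree failures of \<open>n\<close> vertices and
  \<open>2 / n\<close> for all pairs.\<close>

lemma prob_rainbow_connected_ge:
  fixes n s l M b :: nat and c L p \<theta> c\<^sub>1 :: real and X :: "'a set"
  assumes X: "finite X" "card X = n"
    and l: "4 \<le> l" "l \<le> s" "l \<le> n" and n: "n > 0" and L: "L = ln (real n)" and c: "c > 0"
    and p: "p = c * L / (real s * real n)"
    and ratio: "7 * real l \<le> 2 * c * L"
    and total: "real n / 16 \<le> real M * ((c * L) ^ (l - 3) * (real l * exp (- real l)))"
    and M: "2 \<le> M" "16 * M < n" "128 * (5 * L + 1) \<le> real M * (c * L / 2)" "384 * real l \<le> c * real M"
    and n_large: "700 * (5 * L + 1) \<le> real n" "c * L \<le> real n"
    and b: "0 < b" "b \<le> s" "c\<^sub>1 \<le> c * (1 - 2 / real b)" and \<theta>: "\<theta> \<ge> 0"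
  shows "measure_pmf.prob (random_graph_family X s p) {G. rainbow_connected X s G} \<ge>
    1 - (real n * (real b * exp (\<theta> * real (2 * M + 1)
      - (real n - 1) * (1 - exp (- (c\<^sub>1 * L / real n))) * (1 - exp (- \<theta>)))) + 2 / real n)"
proof -
  have n0: "real n > 0" and s0: "real s \<ge> 1" using l n by auto
  have L0: "L \<ge> 0" using n L by simp
  have p0: "0 \<le> p" using c L0 by (simp add: p)
  have "real n \<le> real s * real n" using n0 s0 by simp
  with n_large(2) have "c * L \<le> real s * real n" by linarith
  \<comment> \<open>Hence the clamping in \<open>bernoulli_pmf\<close> never acts.\<close>
  then have p1: "p \<le> 1" using n0 s0 unfolding p by (subst divide_le_eq_1_pos) auto
  interpret colored_random_graph X s p
    by unfold_locales (use X p0 p1 in auto)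
  obtain J N m \<theta>' where J: "J + 3 \<le> l" "N 0 = M" "real n / 128 \<le> real (N J)" "2 * M + m 0 + 2 \<le> n"
    "\<And>k. k < J \<Longrightarrow> 0 \<le> \<theta>' k"
    "\<And>k. k < J \<Longrightarrow> exp (\<theta>' k * real (N (Suc k)) - real (m k) * (1 - exp (- (p * real (N k * (s - 2 - k)))))
       * (1 - exp (- \<theta>' k))) \<le> exp (- (5 * L))"
    "\<And>k. k < J \<Longrightarrow> N (Suc k) + m (Suc k) \<le> m k"
  proof (rule growth_schedule[OF l(1,2) n L0 c p ratio total M(1-3) n_large(1)], goal_cases)
    case 1
    from 1(2-) show ?case by (rule 1(1))
  qed
  define \<eta> where "\<eta> = real b * exp (\<theta> * real (2 * M + 1)
      - (real n - 1) * (1 - exp (- (c\<^sub>1 * L / real n))) * (1 - exp (- \<theta>)))"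
  have degree: "Pr (\<lambda>\<omega>. \<not> good_degree M u \<omega>) \<le> \<eta>" if "u \<in> X" for u
  proof -
    \<comment> \<open>As \<open>b \<le> s\<close>, an excluded class of at most
      \<open>s div b + 1\<close> colours is a share of at most \<open>2 / b\<close>.\<close>
    have "real s * (1 - 2 / real b) = real s - real s / real b - real s / real b"
      by (simp add: algebra_simps)
    also have "\<dots> \<le> real s - real (s div b) - 1"
      using b by (intro diff_mono order_refl of_nat_div_le_of_nat) simp
    also have "\<dots> \<le> real (s - s div b - 1)" by linarith
    finally have "real s * (1 - 2 / real b) \<le> real (s - s div b - 1)" .
    then have "c * L / (real s * real n) * (real s * (1 - 2 / real b)) \<le> p * real (s - s div b - 1)"
      unfolding p using c L0 by (intro mult_left_mono) auto
    then have "c * (1 - 2 / real b) * L / real n \<le> p * real (s - s div b - 1)"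
      using s0 n0 by (simp add: mult_ac)
    moreover have "c\<^sub>1 * L / real n \<le> c * (1 - 2 / real b) * L / real n"
      using b(3) L0 by (intro divide_right_mono mult_right_mono) auto
    ultimately have "c\<^sub>1 * L / real n \<le> p * real (s - s div b - 1)" by linarith
    then have "(real n - 1) * (1 - exp (- (c\<^sub>1 * L / real n))) * (1 - exp (- \<theta>))
        \<le> (real n - 1) * (1 - exp (- (p * real (s - s div b - 1)))) * (1 - exp (- \<theta>))"
      using n \<theta> by (intro mult_right_mono mult_left_mono one_minus_exp_mono) auto
    moreover have "real (card X - 1) = real n - 1" using n X by (simp add: of_nat_diff)
    ultimately have "real b * exp (\<theta> * real (2 * M + 1)
      - real (card X - 1) * (1 - exp (- (p * real (s - s div b - 1)))) * (1 - exp (- \<theta>))) \<le> \<eta>"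
      unfolding \<eta>_def by (intro mult_left_mono) auto
    with good_degree_failure[OF that b(1) \<theta>, of M] show ?thesis by linarith
  qed
  have exp_L: "exp (- (real k * L)) = 1 / real n ^ k" for k
    using n0 by (simp add: L exp_minus exp_of_nat_mult divide_inverse)
  have middle: "(1 - p) ^ (M * N J * (s - 2 - J)) \<le> 1 / real n ^ 3"
  proof -
    \<comment> \<open>\<open>J \<le> l - 3\<close> leaves at least \<open>s - l + 1\<close> colours
      for the final edge, a share of at least \<open>1 / l\<close>.\<close>
    have "(real s - real l + 1) * real l - real s = (real s - real l) * (real l - 1)"
      by (simp add: algebra_simps)
    moreover have "0 \<le> (real s - real l) * (real l - 1)" using l by simp
    ultimately have "1 / real l \<le> (real s - real l + 1) / real s"
      using l s0 by (simp add: field_simps)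
    also have "\<dots> \<le> real (s - 2 - J) / real s"
      using l J(1) by (intro divide_right_mono) auto
    finally have "c * L / real n * (1 / real l) \<le> c * L / real n * (real (s - 2 - J) / real s)"
      using c L0 by (intro mult_left_mono) auto
    then have "c * L / (real n * real l) \<le> p * real (s - 2 - J)"
      by (simp add: p field_simps)
    then have "real M * (real n / 128) * (c * L / (real n * real l)) \<le> real M * real (N J) * (p * real (s - 2 - J))"
      using J(3) c L0 by (intro mult_mono mult_left_mono) auto
    \<comment> \<open>The 384 in the hypothesis is \<open>3 * 128\<close>: exponent 3 for the union
      over pairs, 128 from the size of the last level.\<close>
    moreover have "3 * L \<le> real M * (real n / 128) * (c * L / (real n * real l))"
      using mult_right_mono[OF M(4) L0] l n0 by (simp add: field_simps)
    ultimately have "3 * L \<le> p * real (M * N J * (s - 2 - J))" by (simp add: mult_ac)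
    then have "exp (- (p * real (M * N J * (s - 2 - J)))) \<le> exp (- (real 3 * L))" by simp
    moreover have "(1 - p) ^ (M * N J * (s - 2 - J)) \<le> exp (- p) ^ (M * N J * (s - 2 - J))"
      using p1 exp_ge_add_one_self[of "- p"] by (intro power_mono) auto
    moreover have "exp (- p) ^ (M * N J * (s - 2 - J)) = exp (- (p * real (M * N J * (s - 2 - J))))"
      by (simp add: exp_of_nat_mult[symmetric] mult_ac)
    ultimately show ?thesis using exp_L[of 3] by linarith
  qed
  \<comment> \<open>\<open>M\<close> and \<open>J\<close> are at most \<open>n\<close>, so failure
    probability \<open>n ^ (-5)\<close> per level leaves \<open>n ^ (-3)\<close> per pair.\<close>
  have "real M * (real J * exp (- (5 * L))) \<le> real n * (real n * (1 / real n ^ 5))"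
    using exp_L[of 5] J(1) l M by (intro mult_mono) auto
  also have "\<dots> = 1 / real n ^ 3" using n0 by (simp add: field_simps power_numeral_reduce)
  finally have "(real n)\<^sup>2 * (real M * (real J * exp (- (5 * L))) + (1 - p) ^ (M * N J * (s - 2 - J)))
      \<le> (real n)\<^sup>2 * (1 / real n ^ 3 + 1 / real n ^ 3)"
    using middle by (intro mult_left_mono) auto
  also have "\<dots> = 2 / real n" using n0 by (simp add: field_simps power2_eq_square power3_eq_cube)
  finally have pairs: "(real n)\<^sup>2 * (real M * (real J * exp (- (5 * L))) + (1 - p) ^ (M * N J * (s - 2 - J))) \<le> 2 / real n" .
  have "Pr (\<lambda>\<omega>. \<not> rainbow_connected X s (\<lambda>i. {e \<in> all_edges X. \<omega> (e, i)})) \<le>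
      real (card X) * \<eta> + (real (card X))\<^sup>2 * (real M * (real J * exp (- (5 * L))) + (1 - p) ^ (M * N J * (s - 2 - J)))"
    by (rule rainbow_connected_failure[where \<theta> = \<theta>' and m = m]) (use l J degree X in auto)
  moreover have "measure_pmf.prob (random_graph_family X s p) {G. rainbow_connected X s G}
      = Pr (\<lambda>\<omega>. rainbow_connected X s (\<lambda>i. {e \<in> all_edges X. \<omega> (e, i)}))"
    unfolding random_graph_family_eq_map[OF X(1)] by (simp add: vimage_def)
  ultimately show ?thesis
    using pairs X(2) Pr_compl[of "\<lambda>\<omega>. rainbow_connected X s (\<lambda>i. {e \<in> all_edges X. \<omega> (e, i)})"]
    by (simp add: \<eta>_def)
qed

section \<open>Choice of constants and passage to the limit\<close>

theorem theorem1p3: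
  fixes c :: real and s :: "nat \<Rightarrow> nat" and p :: "nat \<Rightarrow> real" and X :: "nat \<Rightarrow> 'a set"
  assumes "c > 1"
    and "\<And>n. n \<ge> 1 \<Longrightarrow> s n \<ge> 1"
    and "\<And>n. n \<ge> 1 \<Longrightarrow> p n = c * ln (real n) / (real (s n) * real n)"
    and "\<And>n. n \<ge> 1 \<Longrightarrow> finite (X n) \<and> card (X n) = n"
    and "\<forall>\<^sub>F n in sequentially.
           real (s n) \<ge> ln (real n) / (ln c - 1 + ln (ln (real n))) + 3 / 2
             + 2 * sqrt (ln (ln (ln (real n)))) / ln (ln (real n))"
  shows "(\<lambda>n. measure_pmf.prob (random_graph_family (X n) (s n) (p n))
            {G. rainbow_connected (X n) (s n) G}) \<longlonglongrightarrow> 1"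
proof -
  \<comment> \<open>The gap between \<open>c\<close> and 1 is spent in stages:
    \<open>c\<^sub>1\<close> remains after excluding a residue class of colours,
    \<open>c\<^sub>2\<close> after estimating the mean degree, \<open>c\<^sub>3\<close> after the
    Chernoff factor \<open>1 - exp (- \<theta>)\<close>. Being above 1, \<open>c\<^sub>3\<close>
    still beats the union over \<open>n\<close> vertices.\<close>
  define c\<^sub>1 where "c\<^sub>1 = (1 + c) / 2"
  define c\<^sub>2 where "c\<^sub>2 = (1 + c\<^sub>1) / 2"
  define c\<^sub>3 where "c\<^sub>3 = (1 + c\<^sub>2) / 2"
  \<comment> \<open>Makes \<open>2 * c / b\<close> at most \<open>(c - 1) / 2\<close>, which is
    \<open>c - c\<^sub>1\<close>.\<close>
  define b where "b = nat \<lceil>4 * c / (c - 1)\<rceil>"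
  define \<theta> where "\<theta> = - ln (1 - c\<^sub>3 / c\<^sub>2)"
  \<comment> \<open>With \<open>M\<close> about \<open>e * ln n\<close>, the degree requirement
    costs \<open>2 * \<theta> * e = (c\<^sub>3 - 1) / 4\<close> in the exponent of \<open>n\<close>,
    a quarter of the surplus.\<close>
  define e where "e = (c\<^sub>3 - 1) / (8 * \<theta>)"
  have c123: "1 < c\<^sub>3" "c\<^sub>3 < c\<^sub>2" "c\<^sub>2 < c\<^sub>1" "c\<^sub>1 < c"
    using assms(1) by (auto simp: c\<^sub>1_def c\<^sub>2_def c\<^sub>3_def field_simps)
  have frac: "0 < c\<^sub>3 / c\<^sub>2" "c\<^sub>3 / c\<^sub>2 < 1" using c123 by auto
  have \<theta>: "0 < \<theta>" "1 - exp (- \<theta>) = c\<^sub>3 / c\<^sub>2"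
    using frac by (auto simp: \<theta>_def)
  have e: "0 < e" using c123 \<theta> by (simp add: e_def)
  have "0 < 4 * c / (c - 1)" using assms(1) by simp
  then have b: "0 < b" "4 * c / (c - 1) \<le> real b" unfolding b_def by (auto simp: real_nat_ceiling_ge)
  have bc: "c\<^sub>1 \<le> c * (1 - 2 / real b)"
  proof -
    have "4 * c \<le> real b * (c - 1)" using b(2) assms(1) by (simp add: pos_divide_le_eq)
    then have *: "2 * c / real b \<le> (c - 1) / 2" using b(1) by (simp add: field_simps)
    have eq: "c * (1 - 2 / real b) = c - 2 * c / real b" by (simp add: algebra_simps)
    show ?thesis unfolding c\<^sub>1_def eq using * by (simp add: field_simps)
  qed
  define q where "q = (\<lambda>n. ln (real n) / (ln c - 1 + ln (ln (real n))))"
  define l where "l = (\<lambda>n. nat \<lceil>q n + 3 / 2\<rceil>)"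
  define M where "M = (\<lambda>n. nat \<lceil>e * ln (real n)\<rceil>)"
  define bound where "bound = (\<lambda>n. real n * (real b * exp (3 * \<theta> + (c\<^sub>3 - 1) / 4 * ln (real n) - c\<^sub>3 * ln (real n))) + 2 / real n)"

  have q_ge: "\<forall>\<^sub>F n in sequentially. B \<le> q n" for B
    unfolding q_def using assms(1) by real_asymp
  have q_le: "\<forall>\<^sub>F n in sequentially. q n + 5 / 2 \<le> K * ln (real n)" if "K > 0" for K
    unfolding q_def using assms(1) that by real_asymp
  have "\<forall>\<^sub>F n in sequentially. 1 \<le> ln (ln (real n))" by real_asymp
  moreover have "\<forall>\<^sub>F n in sequentially. 1 \<le> ln c - 1 + ln (ln (real n))" by real_asymp
  moreover have "\<forall>\<^sub>F n in sequentially. 2 \<le> e * ln (real n)" using e by real_asymp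
  moreover have "\<forall>\<^sub>F n in sequentially. 16 * (e * ln (real n) + 1) < real n" using e by real_asymp
  moreover have "\<forall>\<^sub>F n in sequentially. 128 * (5 * ln (real n) + 1) \<le> e * ln (real n) * (c * ln (real n) / 2)"
    using e assms(1) by real_asymp
  moreover have "\<forall>\<^sub>F n in sequentially. 700 * (5 * ln (real n) + 1) \<le> real n" by real_asymp
  moreover have "\<forall>\<^sub>F n in sequentially. c * ln (real n) \<le> real n" using assms(1) by real_asymp
  \<comment> \<open>The cube is the price of only \<open>l - 3\<close> levels, and the summand
    \<open>3 / 2\<close> of the threshold pays it: with \<open>L = ln n\<close> the right side has
    order \<open>L^(7/2) / ln L\<close>.\<close>
  moreover have "\<forall>\<^sub>F n in sequentially. (c * ln (real n)) ^ 3 / 16 \<le> e * ln (real n) * q n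
      * exp (3 / 2 * (ln c - 1 + ln (ln (real n))))"
    unfolding q_def using assms(1) e by real_asymp
  moreover have "\<forall>\<^sub>F n in sequentially. c\<^sub>2 * ln (real n) \<le> (real n - 1) * (1 - exp (- (c\<^sub>1 * ln (real n) / real n)))"
    using c123 by real_asymp
  moreover have "\<forall>\<^sub>F n in sequentially. q n + 5 / 2 \<le> 2 * c / 7 * ln (real n)"
    by (rule q_le) (use assms(1) in simp)
  moreover have "\<forall>\<^sub>F n in sequentially. q n + 5 / 2 \<le> c * e / 384 * ln (real n)"
    by (rule q_le) (use assms(1) e in simp)
  moreover have "\<forall>\<^sub>F n in sequentially. q n + 5 / 2 \<le> 1 * ln (real n)"
    by (rule q_le) simp
  moreover note q_ge[of 4] q_ge[of "real b"] eventually_ge_at_top[of "1::nat"] assms(5)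
  ultimately have ev: "\<forall>\<^sub>F n in sequentially. 1 - bound n \<le>
      measure_pmf.prob (random_graph_family (X n) (s n) (p n)) {G. rainbow_connected (X n) (s n) G}"
  proof eventually_elim
    case (elim n)
    define L where "L = ln (real n)"
    define \<Lambda> where "\<Lambda> = ln c - 1 + ln L"
    have n0: "real n > 0" using elim(15) by simp
    have "L \<noteq> 0" using elim(1) by (auto simp: L_def)
    moreover have "L \<ge> 0" using elim(15) by (simp add: L_def)
    ultimately have L: "L > 0" by simp
    have \<Lambda>: "\<Lambda> \<ge> 1" using elim(2) by (simp add: \<Lambda>_def L_def)
    have l_ge: "q n + 3 / 2 \<le> real (l n)" unfolding l_def by (rule real_nat_ceiling_ge)
    have l_le: "real (l n) \<le> q n + 5 / 2" unfolding l_def using elim(13) by linarith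
    have M_ge: "e * L \<le> real (M n)" unfolding M_def L_def by (rule real_nat_ceiling_ge)
    have M_le: "real (M n) \<le> e * L + 1" unfolding M_def L_def using elim(3) by linarith
    \<comment> \<open>So the threshold is at least \<open>q n + 3 / 2\<close>, and the integer
      \<open>s n\<close> at least its ceiling \<open>l n\<close>.\<close>
    have "0 \<le> 2 * sqrt (ln (ln (ln (real n)))) / ln (ln (real n))" using elim(1) by simp
    then have s_ge: "q n + 3 / 2 \<le> real (s n)" using elim(16) unfolding q_def by linarith
    have total: "real n / 16 \<le> real (M n) * ((c * L) ^ (l n - 3) * (real (l n) * exp (- real (l n))))"
    proof -
      have cL: "0 < c * L" using L assms(1) by simp
      have l4: "4 \<le> l n" using l_ge elim(13) by linarith
      \<comment> \<open>\<open>\<Lambda>\<close> is the logarithm of \<open>c * L / exp 1\<close>,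
        so the power of this number with exponent \<open>l n\<close> exceeds \<open>n\<close> by a
        factor of at least \<open>exp (3 / 2 * \<Lambda>)\<close>.\<close>
      have "q n * \<Lambda> = L" using \<Lambda> by (simp add: q_def \<Lambda>_def L_def)
      then have "exp L * exp (3 / 2 * \<Lambda>) = exp ((q n + 3 / 2) * \<Lambda>)"
        by (simp add: distrib_right exp_add)
      also have "\<dots> \<le> exp (real (l n) * \<Lambda>)" using l_ge \<Lambda> by simp
      also have "real (l n) * \<Lambda> = real (l n) * ln (c * L) - real (l n)"
        using L assms(1) by (simp add: \<Lambda>_def ln_mult algebra_simps)
      also have "exp \<dots> = (c * L) ^ (l n) * exp (- real (l n))"
        using cL by (simp add: exp_diff exp_of_nat_mult exp_minus divide_inverse)
      also have "(c * L) ^ (l n) = (c * L) ^ 3 * (c * L) ^ (l n - 3)"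
        using l4 by (simp add: power_add[symmetric])
      finally have *: "real n * exp (3 / 2 * \<Lambda>) \<le> (c * L) ^ 3 * ((c * L) ^ (l n - 3) * exp (- real (l n)))"
        using n0 by (simp add: L_def mult_ac)
      have "(c * L) ^ 3 * (real n / 16) = (c * L) ^ 3 / 16 * real n" by simp
      also have "\<dots> \<le> (e * L * q n * exp (3 / 2 * \<Lambda>)) * real n"
        using elim(8) by (intro mult_right_mono) (auto simp: L_def \<Lambda>_def)
      also have "\<dots> = (e * L * q n) * (real n * exp (3 / 2 * \<Lambda>))" by simp
      also have "\<dots> \<le> (real (M n) * real (l n)) * ((c * L) ^ 3 * ((c * L) ^ (l n - 3) * exp (- real (l n))))"
        using M_ge l_ge elim(13) e L by (intro mult_mono[OF mult_mono *]) auto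
      also have "\<dots> = (c * L) ^ 3 * (real (M n) * ((c * L) ^ (l n - 3) * (real (l n) * exp (- real (l n)))))"
        by (simp add: mult_ac)
      finally show ?thesis using cL by (simp add: mult_le_cancel_left_pos)
    qed
    have "real n * (real b * exp (\<theta> * real (2 * M n + 1)
        - (real n - 1) * (1 - exp (- (c\<^sub>1 * L / real n))) * (1 - exp (- \<theta>)))) + 2 / real n \<le> bound n"
    proof -
      have "\<theta> * real (2 * M n + 1) \<le> \<theta> * (2 * (e * L) + 3)"
        using M_le \<theta> by (intro mult_left_mono) auto
      also have "\<dots> = 3 * \<theta> + (c\<^sub>3 - 1) / 4 * L"
        using \<theta> by (simp add: e_def field_simps)
      finally have 1: "\<theta> * real (2 * M n + 1) \<le> 3 * \<theta> + (c\<^sub>3 - 1) / 4 * L" .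
      have "c\<^sub>3 * L = c\<^sub>2 * L * (c\<^sub>3 / c\<^sub>2)" using c123 by simp
      also have "\<dots> \<le> (real n - 1) * (1 - exp (- (c\<^sub>1 * L / real n))) * (1 - exp (- \<theta>))"
        unfolding \<theta>(2) using elim(9) frac by (intro mult_right_mono) (auto simp: L_def)
      finally show ?thesis
        unfolding bound_def using 1 b(1) n0 by (auto simp: L_def intro!: mult_left_mono)
    qed
    moreover have "1 - (real n * (real b * exp (\<theta> * real (2 * M n + 1)
        - (real n - 1) * (1 - exp (- (c\<^sub>1 * L / real n))) * (1 - exp (- \<theta>)))) + 2 / real n)
      \<le> measure_pmf.prob (random_graph_family (X n) (s n) (p n)) {G. rainbow_connected (X n) (s n) G}"
    proof (rule prob_rainbow_connected_ge[where l = "l n" and M = "M n" and c = c])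
      show "finite (X n)" "card (X n) = n" using assms(4) elim(15) by auto
      show "4 \<le> l n" using l_ge elim(13) by linarith
      show "l n \<le> s n" using s_ge by (simp add: l_def nat_ceiling_le_eq)
      have "L \<le> c * L" using L assms(1) by simp
      then show "l n \<le> n" using l_le elim(7,12) unfolding L_def by linarith
      show "0 < n" using elim(15) by simp
      show "L = ln (real n)" by (simp add: L_def)
      show "p n = c * L / (real (s n) * real n)" using assms(3) elim(15) by (simp add: L_def)
      show "7 * real (l n) \<le> 2 * c * L" using l_le elim(10) by (simp add: L_def)
      show "2 \<le> M n" using M_ge elim(3) unfolding L_def by linarith
      have "16 * real (M n) \<le> 16 * (e * ln (real n) + 1)" using M_le by (simp add: L_def)
      also note elim(4)
      finally show "16 * M n < n" by linarith
      have "e * L * (c * L / 2) \<le> real (M n) * (c * L / 2)"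
        using M_ge L assms(1) by (intro mult_right_mono) auto
      then show "128 * (5 * L + 1) \<le> real (M n) * (c * L / 2)" using elim(5) unfolding L_def by linarith
      have "c * (e * L) \<le> c * real (M n)" using M_ge assms(1) by (intro mult_left_mono) auto
      then show "384 * real (l n) \<le> c * real (M n)" using l_le elim(11) by (simp add: L_def)
      show "700 * (5 * L + 1) \<le> real n" "c * L \<le> real n" using elim(6,7) by (auto simp: L_def)
      show "b \<le> s n" using s_ge elim(14) by linarith
    qed (use assms(1) b bc \<theta> total in auto)
    ultimately show ?case by linarith
  qed
  \<comment> \<open>The exponent of \<open>n\<close> is
    \<open>1 + (c\<^sub>3 - 1) / 4 - c\<^sub>3\<close>, which is negative.\<close>
  have bound_eq: "bound n = real b * exp (3 * \<theta>) * exp (- (3 / 4 * (c\<^sub>3 - 1)) * ln (real n)) + 2 / real n"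
    if "n \<ge> 1" for n
  proof -
    have "exp (3 * \<theta>) * exp (- (3 / 4 * (c\<^sub>3 - 1)) * ln (real n)) =
        exp (ln (real n)) * exp (3 * \<theta> + (c\<^sub>3 - 1) / 4 * ln (real n) - c\<^sub>3 * ln (real n))"
      unfolding exp_add[symmetric] by (simp add: field_simps)
    then show ?thesis using that by (simp add: bound_def)
  qed
  have "0 < 3 / 4 * (c\<^sub>3 - 1)" using c123(1) by simp
  then have "(\<lambda>n. exp (- (3 / 4 * (c\<^sub>3 - 1)) * ln (real n))) \<longlonglongrightarrow> 0" by real_asymp
  moreover have "(\<lambda>n. 2 / real n) \<longlonglongrightarrow> 0" by real_asymp
  ultimately have "(\<lambda>n. real b * exp (3 * \<theta>) * exp (- (3 / 4 * (c\<^sub>3 - 1)) * ln (real n)) + 2 / real n) \<longlonglongrightarrow> 0"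
    by (intro tendsto_add_zero tendsto_mult_right_zero)
  moreover have "\<forall>\<^sub>F n in sequentially.
      real b * exp (3 * \<theta>) * exp (- (3 / 4 * (c\<^sub>3 - 1)) * ln (real n)) + 2 / real n = bound n"
    using eventually_ge_at_top[of "1::nat"] by eventually_elim (simp add: bound_eq)
  ultimately have "bound \<longlonglongrightarrow> 0" by (rule Lim_transform_eventually)
  then have "(\<lambda>n. 1 - bound n) \<longlonglongrightarrow> 1"
    using tendsto_diff[OF tendsto_const, of bound 0 sequentially 1] by simp
  then show ?thesis
    by (rule tendsto_sandwich[OF ev _ _ tendsto_const, rotated]) auto
qed

end
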